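(* Let $n\ge2$, let $G$ be the finite reflection group of type $A_n$ (the symmetric group on $n+1$ letters acting on $V=\mathbb C^{n+1}/(\text{main diagonal})$ by permuting coordinates), and let $\mathcal H$ be its set of reflection hyperplanes $H_{i,j}=(z_i=z_j)$, $0\le i<j\le n$, in $V$. Then any Dunkl form for $\mathcal H$ is proportional to a Lauricella form.
   Context: A Dunkl form for a hyperplane arrangement $\mathcal H$ in a complex vector space $V$ is an $\mathrm{End}(V)$-valued form $\Omega=\sum_{H\in\mathcal H}\omega_H\otimes\kappa_H\pi_H$ on $V^\circ=V\setminus\bigcup_{H\in\mathcal H} H$, where $\omega_H=\phi_H^{-1}d\phi_H$ with $\phi_H$ a linear equation of $H$, $\pi_H$ is the orthogonal projection with kernel $H$ with respect to some (not prescribed) positive definite hermitian inner product on $V$, the $\kappa_H$ are complex numbers, and the connection $\nabla^0-\Omega$ on the tangent bundle of $V^\circ$ is flat ($\nabla^0$ being the translation invariant connection). Lauricella forms: let $\mu_0,\dots,\mu_n$ be nonzero real numbers such that the hermitian form $\sum_i\mu_iz_i\overline{z_i}$ is positive definite on the hyperplane $\sum_i\mu_iz_i=0$ of $\mathbb C^{n+1}$ (for instance, all $\mu_i>0$; but choices with not all $\mu_i$ positive are also allowed as long as the form is positive definite on this hyperplane). This hyperplane is then a complement of the main diagonal and hence is identified with $V$, which thereby acquires an inner product. The associated Lauricella form is $\sum_{i<j}\omega_{H_{i,j}}\otimes(\mu_i+\mu_j)\pi_{H_{i,j}}$, where $\pi_{H_{i,j}}$ is the orthogonal projection with kernel $H_{i,j}$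 for this inner product. Proportional means equal up to a scalar factor.
   Formalization: All exponents κ_H are assumed nonzero; without this the claim fails (n=2, Ω=ω_{01}⊗π_{01} is flat, but every coefficient μ_i+μ_j of a Lauricella form is nonzero). Besides false cases, only the zero form is excluded. *)

theory Defs
  imports "HOL-Analysis.Analysis"
begin

section \<open>Complex normed vector spaces\<close>

class scaleC = scaleR +
  fixes scaleC :: "complex \<Rightarrow> 'a \<Rightarrow> 'a" (infixr "*\<^sub>C" 75)

class complex_normed = real_normed_vector + scaleC +
  assumes scaleC_add_right: "c *\<^sub>C (x + y) = c *\<^sub>C x + c *\<^sub>C y"
    and scaleC_add_left: "(c + d) *\<^sub>C x = c *\<^sub>C x + d *\<^sub>C x"
    and scaleC_scaleC: "c *\<^sub>C (d *\<^sub>C x) = (c * d) *\<^sub>C x"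
    and scaleR_scaleC: "r *\<^sub>R x = of_real r *\<^sub>C x"
    and norm_scaleC: "norm (c *\<^sub>C x) = cmod c * norm x"

lemma vector_space_scaleC: "vector_space (scaleC :: complex \<Rightarrow> 'a \<Rightarrow> 'a::complex_normed)"
proof
  fix x :: 'a
  show "1 *\<^sub>C x = x"
    using scaleR_scaleC[of 1 x] by simp
qed (simp_all add: scaleC_add_right scaleC_add_left scaleC_scaleC)

lemma scaleC_one: "1 *\<^sub>C x = (x::'a::complex_normed)"
  using scaleR_scaleC[of 1 x] by simp

section \<open>Hyperplane arrangements and their logarithmic forms\<close>

text \<open>
  The notions below are meant for finite-dimensional spaces; otherwise continuity of the equations
  would have to be required.
\<close>

definition hyperplane_equation :: "('v::complex_normed \<Rightarrow> complex) \<Rightarrow> 'v set \<Rightarrow> bool" where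
  "hyperplane_equation \<phi> H \<longleftrightarrow>
     Vector_Spaces.linear scaleC (*) \<phi> \<and> (\<exists>x. \<phi> x \<noteq> 0) \<and> H = {x. \<phi> x = 0}"

definition hyperplane :: "'v::complex_normed set \<Rightarrow> bool" where
  "hyperplane H \<longleftrightarrow> (\<exists>\<phi>. hyperplane_equation \<phi> H)"

definition hyperplane_arrangement :: "'v::complex_normed set set \<Rightarrow> bool" where
  "hyperplane_arrangement \<H> \<longleftrightarrow> finite \<H> \<and> (\<forall>H\<in>\<H>. hyperplane H)"

definition arrangement_complement :: "'v set set \<Rightarrow> 'v set" where
  "arrangement_complement \<H> = UNIV - \<Union>\<H>"

text \<open>
  The form \<open>\<omega>\<^sub>H = d\<phi> / \<phi>\<close>, evaluated at the point \<open>z\<close> on the tangent vector \<open>u\<close>.  As \<open>\<phi>\<close> is linear,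
  its differential at every point is \<open>\<phi>\<close> itself.  The choice of \<open>\<phi>\<close> is immaterial, see
  \<open>log_form_eq\<close> below.
\<close>
definition log_form :: "'v::complex_normed set \<Rightarrow> 'v \<Rightarrow> 'v \<Rightarrow> complex" where
  "log_form H z u = (let \<phi> = (SOME \<phi>. hyperplane_equation \<phi> H) in \<phi> u / \<phi> z)"

lemma hyperplane_equation_ratio:
  assumes "hyperplane_equation \<phi> H" "hyperplane_equation \<psi> K" "H \<subseteq> K" "z \<notin> H"
  shows "\<psi> u = (\<phi> u / \<phi> z) * \<psi> z"
proof -
  interpret f: Vector_Spaces.linear scaleC "(*)" \<phi>
    using assms(1) by (simp add: hyperplane_equation_def)
  interpret g: Vector_Spaces.linear scaleC "(*)" \<psi>
    using assms(2) by (simp add: hyperplane_equation_def)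
  have "\<phi> z \<noteq> 0"
    using assms by (simp add: hyperplane_equation_def)
  then have "\<phi> (u - (\<phi> u / \<phi> z) *\<^sub>C z) = 0"
    by (simp add: f.diff f.scale)
  then have "\<psi> (u - (\<phi> u / \<phi> z) *\<^sub>C z) = 0"
    using assms by (auto simp: hyperplane_equation_def)
  then show ?thesis
    by (simp add: g.diff g.scale)
qed

lemma hyperplane_subset_eq:
  assumes "hyperplane H" "hyperplane K" "H \<subseteq> K"
  shows "H = K"
proof (rule ccontr)
  assume "H \<noteq> K"
  then obtain z where z: "z \<in> K" "z \<notin> H"
    using assms(3) by blast
  obtain \<phi> \<psi> where eqs: "hyperplane_equation \<phi> H" "hyperplane_equation \<psi> K"
    using assms(1,2) by (auto simp: hyperplane_def)
  have "\<psi> z = 0"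
    using eqs(2) z(1) by (simp add: hyperplane_equation_def)
  then have "\<psi> u = 0" for u
    using hyperplane_equation_ratio[OF eqs assms(3) z(2), of u] by simp
  then show False
    using eqs(2) by (simp add: hyperplane_equation_def)
qed

lemma log_form_eq:
  assumes "hyperplane_equation \<phi> H" "z \<notin> H"
  shows "log_form H z u = \<phi> u / \<phi> z"
proof -
  define \<psi> where "\<psi> = (SOME \<psi>. hyperplane_equation \<psi> H)"
  have \<psi>: "hyperplane_equation \<psi> H"
    unfolding \<psi>_def using assms(1) by (rule someI[of "\<lambda>f. hyperplane_equation f H"])
  then have "\<psi> z \<noteq> 0"
    using assms(2) by (simp add: hyperplane_equation_def)
  then show ?thesis
    using hyperplane_equation_ratio[OF assms(1) \<psi> order.refl assms(2), of u]
    by (simp add: log_form_def \<psi>_def[symmetric])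
qed

section \<open>Inner products and orthogonal projections\<close>

definition hermitian_inner_product :: "('v::complex_normed \<Rightarrow> 'v \<Rightarrow> complex) \<Rightarrow> bool" where
  "hermitian_inner_product h \<longleftrightarrow>
     (\<forall>x y z. h (x + y) z = h x z + h y z) \<and>
     (\<forall>c x y. h (c *\<^sub>C x) y = c * h x y) \<and>
     (\<forall>x y. h y x = cnj (h x y)) \<and>
     (\<forall>x. x \<noteq> 0 \<longrightarrow> 0 < Re (h x x))"

text \<open>The projection along \<open>H\<close> onto the orthogonal complement of \<open>H\<close>.\<close>
definition orth_proj_kernel :: "('v::complex_normed \<Rightarrow> 'v \<Rightarrow> complex) \<Rightarrow> 'v set \<Rightarrow> 'v \<Rightarrow> 'v" where
  "orth_proj_kernel h H v = (THE p. v - p \<in> H \<and> (\<forall>w\<in>H. h p w = 0))"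

section \<open>Flat connections\<close>

text \<open>
  An \<open>End(V)\<close>-valued 1-form is a function \<open>\<Omega>\<close> such that \<open>\<Omega> z u\<close> is the endomorphism obtained at the
  point \<open>z\<close> from the tangent vector \<open>u\<close>; the tangent bundle of an open subset of \<open>V\<close> is trivialized by
  translations, so that vector fields are \<open>V\<close>-valued functions.
\<close>

definition holomorphic_field :: "('v::complex_normed \<Rightarrow> 'v) \<Rightarrow> 'v set \<Rightarrow> bool" where
  "holomorphic_field X U \<longleftrightarrow>
     (\<forall>z\<in>U. \<exists>D. (X has_derivative D) (at z) \<and> (\<forall>c u. D (c *\<^sub>C u) = c *\<^sub>C D u))"

text \<open>The covariant derivative of \<open>Y\<close> in the direction \<open>X\<close> for the connection \<open>\<nabla>\<^sup>0 - \<Omega>\<close>.\<close>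
definition covariant_derivative ::
    "('v::complex_normed \<Rightarrow> 'v \<Rightarrow> 'v \<Rightarrow> 'v) \<Rightarrow> ('v \<Rightarrow> 'v) \<Rightarrow> ('v \<Rightarrow> 'v) \<Rightarrow> 'v \<Rightarrow> 'v" where
  "covariant_derivative \<Omega> X Y z = frechet_derivative Y (at z) (X z) - \<Omega> z (X z) (Y z)"

definition lie_bracket :: "('v::complex_normed \<Rightarrow> 'v) \<Rightarrow> ('v \<Rightarrow> 'v) \<Rightarrow> 'v \<Rightarrow> 'v" where
  "lie_bracket X Y z = frechet_derivative Y (at z) (X z) - frechet_derivative X (at z) (Y z)"

definition curvature ::
    "('v::complex_normed \<Rightarrow> 'v \<Rightarrow> 'v \<Rightarrow> 'v) \<Rightarrow> ('v \<Rightarrow> 'v) \<Rightarrow> ('v \<Rightarrow> 'v) \<Rightarrow> ('v \<Rightarrow> 'v) \<Rightarrow> 'v \<Rightarrow> 'v" where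
  "curvature \<Omega> X Y S z =
     covariant_derivative \<Omega> X (covariant_derivative \<Omega> Y S) z
     - covariant_derivative \<Omega> Y (covariant_derivative \<Omega> X S) z
     - covariant_derivative \<Omega> (lie_bracket X Y) S z"

text \<open>
  Flatness is vanishing of the curvature.  The forms considered here are holomorphic of type (1,0),
  so the curvature has no other components than those seen by holomorphic vector fields.
\<close>
definition flat_connection_on ::
    "'v::complex_normed set \<Rightarrow> ('v \<Rightarrow> 'v \<Rightarrow> 'v \<Rightarrow> 'v) \<Rightarrow> bool" where
  "flat_connection_on U \<Omega> \<longleftrightarrow>
     (\<forall>W X Y S. open W \<and> W \<subseteq> U \<and>
        holomorphic_field X W \<and> holomorphic_field Y W \<and> holomorphic_field S W \<longrightarrow>
        (\<forall>z\<in>W. curvature \<Omega> X Y S z = 0))"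

section \<open>Dunkl forms\<close>

text \<open>
  \<open>\<Omega>\<close> is the Dunkl form for \<open>\<H>\<close> with inner product \<open>h\<close> and exponents \<open>\<kappa>\<close>.  Only the values of \<open>\<Omega>\<close>
  on the complement of the arrangement matter.
\<close>
definition dunkl_form ::
    "'v::complex_normed set set \<Rightarrow> ('v \<Rightarrow> 'v \<Rightarrow> complex) \<Rightarrow> ('v set \<Rightarrow> complex) \<Rightarrow>
     ('v \<Rightarrow> 'v \<Rightarrow> 'v \<Rightarrow> 'v) \<Rightarrow> bool" where
  "dunkl_form \<H> h \<kappa> \<Omega> \<longleftrightarrow>
     hyperplane_arrangement \<H> \<and>
     hermitian_inner_product h \<and>
     (\<forall>z\<in>arrangement_complement \<H>. \<forall>u v.
        \<Omega> z u v = (\<Sum>H\<in>\<H>. log_form H z u *\<^sub>C \<kappa> H *\<^sub>C orth_proj_kernel h H v)) \<and>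
     flat_connection_on (arrangement_complement \<H>) \<Omega>"

section \<open>The reflection representation of type A\<close>

definition mean :: "complex ^ 'n \<Rightarrow> complex" where
  "mean z = (\<Sum>i\<in>UNIV. z $ i) / of_nat CARD('n::finite)"

definition centre :: "complex ^ 'n \<Rightarrow> complex ^ 'n::finite" where
  "centre z = z - vec (mean z)"

lemma mean_add: "mean (x + y) = mean x + mean y"
  by (simp add: mean_def sum.distrib add_divide_distrib)

lemma mean_scale: "mean (c *s x) = c * mean x"
  by (simp add: mean_def sum_distrib_left)

lemma mean_vec: "mean (vec c :: complex ^ 'n::finite) = c"
  by (simp add: mean_def)

lemma centre_add: "centre (x + y) = centre x + centre y"
  by (simp add: centre_def mean_add vec_eq_iff)

lemma centre_scale: "centre (c *s x) = c *s centre x"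
  by (simp add: centre_def mean_scale vec_eq_iff algebra_simps)

lemma centre_eq_0_iff: "centre x = 0 \<longleftrightarrow> (\<exists>c. x = vec c)"
  by (auto simp: centre_def mean_vec)

lemma centre_eq_iff: "centre x = centre y \<longleftrightarrow> (\<exists>c. x - y = vec c)"
proof -
  have "centre (x + (-1) *s y) = centre x + (-1) *s centre y"
    by (simp only: centre_add centre_scale)
  then have "centre (x - y) = centre x - centre y"
    by (simp add: vec_eq_iff)
  then show ?thesis
    using centre_eq_0_iff[of "x - y"] by simp
qed

lemma norm_vector_scale: "norm (c *s (x :: complex ^ 'n::finite)) = cmod c * norm x"
  by (simp add: norm_vec_def norm_mult L2_set_right_distrib)

text \<open>\<open>'n type_A\<close> is the quotient of \<open>complex ^ 'n\<close> by its main diagonal.\<close>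
definition diag_rel :: "complex ^ 'n \<Rightarrow> complex ^ 'n::finite \<Rightarrow> bool" where
  "diag_rel x y \<longleftrightarrow> (\<exists>c. x - y = vec c)"

lemma diag_rel_centre: "diag_rel x y \<longleftrightarrow> centre x = centre y"
  by (simp add: diag_rel_def centre_eq_iff)

quotient_type (overloaded) 'n type_A = "complex ^ ('n::finite)" / diag_rel
  morphisms rep_type_A proj_type_A
  by (rule equivpI) (auto simp: diag_rel_centre reflp_def symp_def transp_def)

text \<open>
  Subtracting the mean is the orthogonal projection with kernel the diagonal, so the norm below
  is the quotient norm of the Euclidean one.  It only serves to provide the topology.
\<close>
instantiation type_A :: (finite) complex_normed
begin

lift_definition zero_type_A :: "'a type_A" is 0 .

lift_definition plus_type_A :: "'a type_A \<Rightarrow> 'a type_A \<Rightarrow> 'a type_A" is "(+)"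
  by (simp add: diag_rel_centre centre_add)

lift_definition scaleC_type_A :: "complex \<Rightarrow> 'a type_A \<Rightarrow> 'a type_A" is "(*s)"
  by (simp add: diag_rel_centre centre_scale)

lift_definition norm_type_A :: "'a type_A \<Rightarrow> real" is "\<lambda>x. norm (centre x)"
  by (simp add: diag_rel_centre)

definition uminus_type_A :: "'a type_A \<Rightarrow> 'a type_A" where
  "uminus_type_A x = (-1) *\<^sub>C x"

definition minus_type_A :: "'a type_A \<Rightarrow> 'a type_A \<Rightarrow> 'a type_A" where
  "minus_type_A x y = x + - y"

definition scaleR_type_A :: "real \<Rightarrow> 'a type_A \<Rightarrow> 'a type_A" where
  "scaleR_type_A r x = of_real r *\<^sub>C x"

definition dist_type_A :: "'a type_A \<Rightarrow> 'a type_A \<Rightarrow> real" where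
  "dist_type_A x y = norm (x - y)"

definition sgn_type_A :: "'a type_A \<Rightarrow> 'a type_A" where
  "sgn_type_A x = inverse (norm x) *\<^sub>R x"

definition uniformity_type_A :: "('a type_A \<times> 'a type_A) filter" where
  "uniformity_type_A = (INF e\<in>{0<..}. principal {(x, y). dist x y < e})"

definition open_type_A :: "'a type_A set \<Rightarrow> bool" where
  "open_type_A U \<longleftrightarrow> (\<forall>x\<in>U. eventually (\<lambda>(x', y). x' = x \<longrightarrow> y \<in> U) uniformity)"

instance
proof
  fix x y z :: "'a type_A" and c d :: complex and r s :: real
  show add_assoc: "x + y + z = x + (y + z)"
    by transfer (simp add: diag_rel_centre add.assoc)
  show "x + y = y + x"
    by transfer (simp add: diag_rel_centre add.commute)
  show "0 + x = x"
    by transfer (simp add: diag_rel_centre)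
  show "- x + x = 0"
    unfolding uminus_type_A_def
    by transfer (auto simp: diag_rel_def vec_eq_iff intro: exI[of _ 0])
  show "x - y = x + - y"
    by (simp add: minus_type_A_def)
  show add_right: "c *\<^sub>C (x + y) = c *\<^sub>C x + c *\<^sub>C y" for c :: complex and x y :: "'a type_A"
    by transfer (simp add: diag_rel_centre vector_add_ldistrib)
  show add_left: "(c + d) *\<^sub>C x = c *\<^sub>C x + d *\<^sub>C x" for c d :: complex and x :: "'a type_A"
    by transfer (simp add: diag_rel_centre vector_sadd_rdistrib)
  show assoc: "c *\<^sub>C d *\<^sub>C x = (c * d) *\<^sub>C x" for c d :: complex and x :: "'a type_A"
    by transfer (simp add: diag_rel_centre vector_smult_assoc)
  show norm_C: "norm (c *\<^sub>C x) = cmod c * norm x" for c :: complex and x :: "'a type_A"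
    by transfer (simp add: centre_scale norm_vector_scale)
  show "r *\<^sub>R x = of_real r *\<^sub>C x"
    by (simp add: scaleR_type_A_def)
  show "r *\<^sub>R (x + y) = r *\<^sub>R x + r *\<^sub>R y" "(r + s) *\<^sub>R x = r *\<^sub>R x + s *\<^sub>R x"
    "r *\<^sub>R s *\<^sub>R x = (r * s) *\<^sub>R x"
    by (simp_all add: scaleR_type_A_def add_right add_left assoc)
  show "1 *\<^sub>R x = x"
    unfolding scaleR_type_A_def by transfer (simp add: diag_rel_centre)
  show "dist x y = norm (x - y)"
    by (simp add: dist_type_A_def)
  show "sgn x = inverse (norm x) *\<^sub>R x"
    by (simp add: sgn_type_A_def)
  show "uniformity = (INF e\<in>{0<..}. principal {(x, y :: 'a type_A). dist x y < e})"
    by (simp add: uniformity_type_A_def)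
  show "open U \<longleftrightarrow> (\<forall>x\<in>U. eventually (\<lambda>(x', y). x' = x \<longrightarrow> y \<in> U) uniformity)"
    for U :: "'a type_A set"
    by (simp add: open_type_A_def)
  show "norm x = 0 \<longleftrightarrow> x = 0"
    by transfer (simp add: diag_rel_def centre_eq_0_iff)
  show "norm (x + y) \<le> norm x + norm y"
    by transfer (simp add: centre_add norm_triangle_ineq)
  show "norm (r *\<^sub>R x) = \<bar>r\<bar> * norm x"
    by (simp add: scaleR_type_A_def norm_C)
qed

end

lemma proj_type_A_add: "proj_type_A (x + y) = proj_type_A x + proj_type_A y"
  by (simp add: plus_type_A.abs_eq)

lemma proj_type_A_scale: "proj_type_A (c *s x) = c *\<^sub>C proj_type_A x"
  by (simp add: scaleC_type_A.abs_eq)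

lemma proj_type_A_eq_iff: "proj_type_A x = proj_type_A y \<longleftrightarrow> (\<exists>c. x - y = vec c)"
  by (simp add: type_A.abs_eq_iff diag_rel_def)

lemma diag_rel_coord_diff:
  assumes "diag_rel x y"
  shows "x $ i - x $ j = y $ i - y $ j"
proof -
  obtain c where c: "x - y = vec c"
    using assms by (auto simp: diag_rel_def)
  have "x $ k - y $ k = c" for k
    using c by (metis vec_component vector_minus_component)
  then have "x $ i - y $ i = x $ j - y $ j"
    by simp
  then show ?thesis
    by algebra
qed

text \<open>The linear form \<open>z\<^sub>i - z\<^sub>j\<close> and the hyperplane \<open>H\<^sub>i\<^sub>j\<close> on the quotient.\<close>
lift_definition coord_diff :: "'n \<Rightarrow> 'n \<Rightarrow> 'n::finite type_A \<Rightarrow> complex"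
  is "\<lambda>i j z. z $ i - z $ j"
  by (rule diag_rel_coord_diff)

definition root_hyperplane :: "'n \<Rightarrow> 'n \<Rightarrow> 'n::finite type_A set" where
  "root_hyperplane i j = {x. coord_diff i j x = 0}"

definition arrangement_A :: "'n::{finite,linorder} type_A set set" where
  "arrangement_A = {root_hyperplane i j | i j. i < j}"

lemma hyperplane_equation_root_hyperplane:
  assumes "i \<noteq> j"
  shows "hyperplane_equation (coord_diff i j) (root_hyperplane i j)"
proof -
  interpret vector_space "scaleC :: complex \<Rightarrow> 'a type_A \<Rightarrow> 'a type_A"
    by (rule vector_space_scaleC)
  have "Vector_Spaces.linear scaleC (*) (coord_diff i j)"
  proof
    fix x y :: "'a type_A" and c :: complex
    show "coord_diff i j (x + y) = coord_diff i j x + coord_diff i j y"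
      by transfer simp
    show "coord_diff i j (c *\<^sub>C x) = c * coord_diff i j x"
      by transfer (simp add: algebra_simps)
  qed
  moreover have "coord_diff i j (proj_type_A (axis i 1)) \<noteq> 0"
    using assms by (simp add: coord_diff.abs_eq axis_def)
  ultimately show ?thesis
    by (auto simp: hyperplane_equation_def root_hyperplane_def)
qed

text \<open>
  The action of the symmetric group, and the fact that the hyperplanes \<open>H\<^sub>i\<^sub>j\<close> are exactly
  its reflection hyperplanes.
\<close>
lift_definition perm_action :: "('n \<Rightarrow> 'n) \<Rightarrow> 'n::finite type_A \<Rightarrow> 'n type_A"
  is "\<lambda>\<sigma> z. \<chi> i. z $ (inv \<sigma> i)"
  by (auto simp: diag_rel_def vec_eq_iff)

definition reflection_hyperplanes_A :: "'n::finite type_A set set" where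
  "reflection_hyperplanes_A = {H. hyperplane H \<and> (\<exists>\<sigma>. bij \<sigma> \<and> H = {x. perm_action \<sigma> x = x})}"

lemma perm_action_fixed_iff:
  assumes "bij \<sigma>"
  shows "perm_action \<sigma> (proj_type_A z) = proj_type_A z \<longleftrightarrow> (\<forall>i. z $ (\<sigma> i) = z $ i)"
proof
  assume "perm_action \<sigma> (proj_type_A z) = proj_type_A z"
  then obtain c where c: "\<And>i. z $ (inv \<sigma> i) - z $ i = c"
    by (auto simp: perm_action.abs_eq proj_type_A_eq_iff vec_eq_iff)
  have "(\<Sum>i\<in>UNIV. z $ (inv \<sigma> i)) = (\<Sum>i\<in>UNIV. z $ i)"
    using bij_imp_bij_inv[OF assms] by (rule sum.reindex_bij_betw)
  then have "(\<Sum>i\<in>UNIV. z $ (inv \<sigma> i) - z $ i) = 0"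
    by (simp add: sum_subtractf)
  then have "c = 0"
    by (simp add: c)
  then show "\<forall>i. z $ (\<sigma> i) = z $ i"
    using c bij_is_inj[OF assms] by (metis eq_iff_diff_eq_0 inv_f_f)
next
  assume *: "\<forall>i. z $ (\<sigma> i) = z $ i"
  have "z $ (inv \<sigma> i) = z $ i" for i
    using * bij_is_surj[OF assms] by (metis surj_f_inv_f)
  then show "perm_action \<sigma> (proj_type_A z) = proj_type_A z"
    by (simp add: perm_action.abs_eq)
qed

lemma arrangement_A_eq_reflection_hyperplanes:
  "(arrangement_A :: 'n::{finite,linorder} type_A set set) = reflection_hyperplanes_A"
proof (intro equalityI subsetI)
  fix H :: "'n type_A set"
  assume "H \<in> arrangement_A"
  then obtain i j where ij: "i < j" "H = root_hyperplane i j"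
    by (auto simp: arrangement_A_def)
  let ?\<sigma> = "\<lambda>k. if k = i then j else if k = j then i else k"
  have "bij ?\<sigma>"
    by (rule involuntory_imp_bij) auto
  moreover have "x \<in> H \<longleftrightarrow> perm_action ?\<sigma> x = x" for x
  proof (induction x rule: type_A.abs_induct)
    case (1 z)
    show ?case
      using ij(1) unfolding perm_action_fixed_iff[OF \<open>bij ?\<sigma>\<close>]
      by (auto simp: ij(2) root_hyperplane_def coord_diff.abs_eq)
  qed
  moreover have "hyperplane H"
    using hyperplane_equation_root_hyperplane[of i j] ij by (auto simp: hyperplane_def)
  ultimately show "H \<in> reflection_hyperplanes_A"
    unfolding reflection_hyperplanes_A_def by blast
next
  fix H :: "'n type_A set"
  assume "H \<in> reflection_hyperplanes_A"
  then obtain \<sigma> where H: "hyperplane H" and \<sigma>: "bij \<sigma>" "H = {x. perm_action \<sigma> x = x}"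
    by (auto simp: reflection_hyperplanes_A_def)
  have "\<exists>i. \<sigma> i \<noteq> i"
  proof (rule ccontr)
    assume "\<nexists>i. \<sigma> i \<noteq> i"
    then have "perm_action \<sigma> x = x" for x
      by (induction x rule: type_A.abs_induct) (simp add: perm_action_fixed_iff[OF \<sigma>(1)])
    then have "H = UNIV"
      using \<sigma>(2) by auto
    then show False
      using H unfolding hyperplane_def hyperplane_equation_def by blast
  qed
  then obtain i where i: "\<sigma> i \<noteq> i"
    by blast
  have "x \<in> H \<Longrightarrow> x \<in> root_hyperplane (\<sigma> i) i" for x
    by (induction x rule: type_A.abs_induct)
       (simp add: \<sigma>(2) perm_action_fixed_iff[OF \<sigma>(1)] root_hyperplane_def coord_diff.abs_eq)
  then have eq: "H = root_hyperplane (\<sigma> i) i"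
    using hyperplane_equation_root_hyperplane[OF i]
    by (intro hyperplane_subset_eq[OF H]) (auto simp: hyperplane_def)
  have "coord_diff a b x = 0 \<longleftrightarrow> coord_diff b a x = 0" for a b :: 'n and x
    by transfer auto
  then have swap: "root_hyperplane a b = root_hyperplane b a" for a b :: 'n
    unfolding root_hyperplane_def by (rule Collect_cong)
  show "H \<in> arrangement_A"
  proof (cases "\<sigma> i < i")
    case True
    then show ?thesis
      using eq unfolding arrangement_A_def by blast
  next
    case False
    then have "i < \<sigma> i"
      using i by simp
    then show ?thesis
      using eq swap[of "\<sigma> i" i] unfolding arrangement_A_def by blast
  qed
qed

section \<open>Lauricella forms\<close>

definition lauricella_weights :: "('n::finite \<Rightarrow> real) \<Rightarrow> bool" where
  "lauricella_weights \<mu> \<longleftrightarrow>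
     (\<forall>i. \<mu> i \<noteq> 0) \<and>
     (\<forall>z :: complex ^ 'n. (\<Sum>i\<in>UNIV. of_real (\<mu> i) * z $ i) = 0 \<and> z \<noteq> 0 \<longrightarrow>
        0 < (\<Sum>i\<in>UNIV. \<mu> i * (cmod (z $ i))\<^sup>2))"

text \<open>
  For \<open>lauricella_weights \<mu>\<close> the hyperplane \<open>\<Sum>\<^sub>i \<mu>\<^sub>i z\<^sub>i = 0\<close> is a complement of the diagonal;
  \<open>lauricella_lift \<mu>\<close> is the resulting identification of the quotient with that hyperplane.
\<close>
definition lauricella_lift :: "('n \<Rightarrow> real) \<Rightarrow> 'n::finite type_A \<Rightarrow> complex ^ 'n" where
  "lauricella_lift \<mu> x =
     (THE z. proj_type_A z = x \<and> (\<Sum>i\<in>UNIV. of_real (\<mu> i) * z $ i) = 0)"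

definition lauricella_inner ::
    "('n \<Rightarrow> real) \<Rightarrow> 'n::finite type_A \<Rightarrow> 'n type_A \<Rightarrow> complex" where
  "lauricella_inner \<mu> x y =
     (\<Sum>i\<in>UNIV. of_real (\<mu> i) * lauricella_lift \<mu> x $ i * cnj (lauricella_lift \<mu> y $ i))"

definition lauricella_form ::
    "('n \<Rightarrow> real) \<Rightarrow> 'n::{finite,linorder} type_A \<Rightarrow> 'n type_A \<Rightarrow> 'n type_A \<Rightarrow> 'n type_A" where
  "lauricella_form \<mu> z u v =
     (\<Sum>(i, j)\<in>{(i, j). i < j}.
        log_form (root_hyperplane i j) z u *\<^sub>C of_real (\<mu> i + \<mu> j) *\<^sub>C
        orth_proj_kernel (lauricella_inner \<mu>) (root_hyperplane i j) v)"

end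

theory Submission
  imports Defs
begin

text \<open>
  Let \<open>e i j\<close> be the vector that represents the linear form \<open>z\<^sub>i - z\<^sub>j\<close> with respect to \<open>h\<close> (the
  \<open>root_vector\<close> below), so that the projection \<open>\<pi>\<^sub>H\<close> for \<open>H = H\<^sub>i\<^sub>j\<close> maps \<open>s\<close> to
  \<open>(h s (e i j) / h (e i j) (e i j)) e i j\<close>.  The theorem compares Gram matrices of these vectors: an
  inner product on \<open>V\<close> is determined by the numbers \<open>h (e i j) (e k l)\<close>.

  Flatness enters through one classical consequence (\<open>residue_commute\<close>): for every point \<open>p\<close> and
  every \<open>H\<close> through \<open>p\<close>, the endomorphism \<open>\<kappa>\<^sub>H \<pi>\<^sub>H\<close> commutes with the sum of all \<open>\<kappa>\<^sub>K \<pi>\<^sub>K\<close> with \<open>K\<close>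
  through \<open>p\<close>.  For constant vector fields the derivative terms of the curvature cancel, because
  every \<open>\<omega>\<^sub>H\<close> is closed; so the endomorphisms \<open>\<Omega>\<^sub>z(u)\<close> and \<open>\<Omega>\<^sub>z(v)\<close> commute (\<open>dunkl_commute\<close>).  Letting \<open>z\<close>
  tend to \<open>p\<close> along a curve that approaches \<open>H\<close> faster than the other hyperplanes through \<open>p\<close>, and
  choosing \<open>u\<close> and \<open>v\<close> suitably, picks out the two endomorphisms in question.

  Generic points \<open>p\<close> of the intersections of codimension two give all that is needed.  If \<open>i, j, k, l\<close>
  are distinct, then \<open>e i j\<close> and \<open>e k l\<close> are orthogonal (\<open>root_vectors_orthogonal\<close>).  If \<open>i, j, k\<close> are
  distinct, then, with \<open>w i j = \<kappa> H\<^sub>i\<^sub>j / h (e i j) (e i j)\<close>, the number \<open>h (e i j) (e i k)\<close> is real and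
  nonzero and \<open>w j k * h (e i j) (e j k) = w k i * h (e i j) (e k i)\<close> (\<open>triple_relations\<close>).

  As \<open>e i k - e i l = e l k\<close>, the orthogonality relations show that \<open>h (e i j) (e i k)\<close> is a real
  number \<open>\<lambda>\<^sub>i\<close> depending on \<open>i\<close> only (\<open>gram_invariants\<close>), and \<open>e i j = e i k + e k j\<close> gives
  \<open>h (e i j) (e i j) = \<lambda>\<^sub>i + \<lambda>\<^sub>j\<close>.  Put \<open>\<mu>\<^sub>i = 1 / \<lambda>\<^sub>i\<close>.  For the form \<open>\<Sum>\<^sub>i \<mu>\<^sub>i |z\<^sub>i|\<^sup>2\<close> on the hyperplane
  \<open>\<Sum>\<^sub>i \<mu>\<^sub>i z\<^sub>i = 0\<close>, the linear form \<open>z\<^sub>i - z\<^sub>j\<close> is represented by the vector with entries \<open>1 / \<mu>\<^sub>i\<close> at \<open>i\<close> and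
  \<open>- 1 / \<mu>\<^sub>j\<close> at \<open>j\<close>, and these vectors have the same Gram matrix as the \<open>e i j\<close>.  Hence \<open>h\<close> is the
  Lauricella inner product of \<open>\<mu>\<close>, which in particular inherits positivity from \<open>h\<close>
  (\<open>lauricella_of_gram\<close>).  The remaining relation now reads \<open>w j k * \<lambda>\<^sub>j = w k i * \<lambda>\<^sub>i\<close>: the number
  \<open>w j k * \<lambda>\<^sub>j * \<lambda>\<^sub>k\<close> does not change when one index is replaced, and so it is a constant \<open>c\<close>.  Therefore
  \<open>\<kappa> H\<^sub>i\<^sub>j = w i j * (\<lambda>\<^sub>i + \<lambda>\<^sub>j) = c * (\<mu>\<^sub>i + \<mu>\<^sub>j)\<close>.
\<close>

section \<open>Hermitian inner products\<close>

lemma module_scaleC: "module (scaleC :: complex \<Rightarrow> 'v \<Rightarrow> 'v::complex_normed)"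
  using vector_space_scaleC by (simp add: module_iff_vector_space)

lemmas scaleC_zero_left [simp] = module.scale_zero_left [OF module_scaleC]
  and scaleC_zero_right [simp] = module.scale_zero_right [OF module_scaleC]
  and scaleC_minus_left [simp] = module.scale_minus_left [OF module_scaleC]
  and scaleC_minus_right [simp] = module.scale_minus_right [OF module_scaleC]
  and scaleC_sum_right = module.scale_sum_right [OF module_scaleC]

lemma bounded_bilinear_scaleC:
  "bounded_bilinear (scaleC :: complex \<Rightarrow> 'v \<Rightarrow> 'v::complex_normed)"
proof
  fix a :: complex and b :: 'v and r :: real
  show "(r *\<^sub>R a) *\<^sub>C b = r *\<^sub>R a *\<^sub>C b"
    by (simp add: scaleR_scaleC scaleC_scaleC scaleR_conv_of_real)
  show "a *\<^sub>C r *\<^sub>R b = r *\<^sub>R a *\<^sub>C b"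
    by (simp add: scaleR_scaleC scaleC_scaleC mult.commute)
  show "\<exists>K. \<forall>(a::complex) (b::'v). norm (a *\<^sub>C b) \<le> norm a * norm b * K"
    by (intro exI[of _ 1]) (simp add: norm_scaleC)
qed (simp_all add: scaleC_add_right scaleC_add_left)

locale hermitian =
  fixes h :: "'v::complex_normed \<Rightarrow> 'v \<Rightarrow> complex"
  assumes inner_product: "hermitian_inner_product h"
begin

lemma add_left [simp]: "h (x + y) z = h x z + h y z"
  and scaleC_left [simp]: "h (c *\<^sub>C x) y = c * h x y"
  and commute: "h y x = cnj (h x y)"
  and positive: "x \<noteq> 0 \<Longrightarrow> 0 < Re (h x x)"
  using inner_product unfolding hermitian_inner_product_def by blast+

lemma add_right [simp]: "h x (y + z) = h x y + h x z"
  by (metis add_left commute complex_cnj_add)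

lemma scaleC_right [simp]: "h x (c *\<^sub>C y) = cnj c * h x y"
  by (metis scaleC_left commute complex_cnj_mult complex_cnj_cnj)

lemma zero_left [simp]: "h 0 x = 0"
  using scaleC_left[of 0 0 x] by simp

lemma zero_right [simp]: "h x 0 = 0"
  using scaleC_right[of x 0 0] by simp

lemma minus_left [simp]: "h (- x) y = - h x y"
  using add_left[of x "- x" y] by (simp add: eq_neg_iff_add_eq_0 add.commute)

lemma minus_right [simp]: "h x (- y) = - h x y"
  using add_right[of x y "- y"] by (simp add: eq_neg_iff_add_eq_0 add.commute)

lemma diff_left [simp]: "h (x - y) z = h x z - h y z"
  using add_left[of x "- y" z] by simp

lemma diff_right [simp]: "h x (y - z) = h x y - h x z"
  using add_right[of x y "- z"] by simp

lemma sum_right: "h x (sum f I) = (\<Sum>i\<in>I. h x (f i))"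
  by (induction I rule: infinite_finite_induct) auto

lemma scaleR_left [simp]: "h (r *\<^sub>R x) y = of_real r * h x y"
  by (simp add: scaleR_scaleC)

lemma self_eq_0_iff [simp]: "h x x = 0 \<longleftrightarrow> x = 0"
  using positive[of x] by (metis less_irrefl zero_complex.sel(1) zero_left)

lemma eqI_right:
  assumes "\<And>x. h x y = h x z"
  shows "y = z"
  using assms[of "y - z"] self_eq_0_iff[of "y - z"] by (simp add: algebra_simps)

definition normal_to :: "'v \<Rightarrow> 'v set \<Rightarrow> bool" where
  "normal_to e H \<longleftrightarrow> e \<noteq> 0 \<and> H = {x. h x e = 0}"

lemma hyperplane_equation_normal:
  assumes "normal_to e H"
  shows "hyperplane_equation (\<lambda>x. h x e) H"
proof -
  interpret vector_space "scaleC :: complex \<Rightarrow> 'v \<Rightarrow> 'v"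
    by (rule vector_space_scaleC)
  have "Vector_Spaces.linear scaleC (*) (\<lambda>x. h x e)"
    by unfold_locales (simp_all add: algebra_simps)
  moreover have "h e e \<noteq> 0"
    using assms by (simp add: normal_to_def)
  ultimately show ?thesis
    using assms unfolding hyperplane_equation_def normal_to_def by blast
qed

lemma log_form_normal:
  assumes "normal_to e H" "z \<notin> H"
  shows "log_form H z u = h u e / h z e"
  using log_form_eq[OF hyperplane_equation_normal[OF assms(1)] assms(2)] .

lemma orth_proj_kernel_normal:
  assumes "normal_to e H"
  shows "orth_proj_kernel h H v = (h v e / h e e) *\<^sub>C e"
proof -
  have e: "h e e \<noteq> 0" "e \<noteq> 0" and H: "H = {x. h x e = 0}"
    using assms by (auto simp: normal_to_def)
  show ?thesis
    unfolding orth_proj_kernel_def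
  proof (rule the_equality)
    have "h e w = 0" if "w \<in> H" for w
      using that commute[of w e] by (simp add: H)
    then show "v - (h v e / h e e) *\<^sub>C e \<in> H \<and> (\<forall>w\<in>H. h ((h v e / h e e) *\<^sub>C e) w = 0)"
      using e by (simp add: H)
  next
    fix p assume p: "v - p \<in> H \<and> (\<forall>w\<in>H. h p w = 0)"
    define d where "d = p - (h v e / h e e) *\<^sub>C e"
    have d: "h d e = 0"
      using p e by (simp add: H d_def)
    have "h p d = 0"
      using p d by (auto simp: H)
    moreover have "h e d = 0"
      using d commute[of d e] by simp
    ultimately have "h d d = 0"
      by (subst (1) d_def) simp
    then have "d = 0"
      by (simp only: self_eq_0_iff)
    then show "p = (h v e / h e e) *\<^sub>C e"
      by (simp add: d_def)
  qed
qed

end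

section \<open>Flatness of Dunkl forms\<close>

text \<open>
  Asymptotics of an equation with value \<open>P + t R + t\<^sup>2 Q\<close> along a curve: the order of contact with the
  hyperplane at \<open>t = 0\<close> decides which of the two rescaled logarithmic derivatives survive in the
  limit.
\<close>
lemma parabola_limits:
  fixes P Q R :: complex
  defines "a \<equiv> \<lambda>t. P + of_real t * R + of_real (t\<^sup>2) * Q"
  assumes nz: "P \<noteq> 0 \<or> R \<noteq> 0 \<or> Q \<noteq> 0"
  shows "\<forall>\<^sub>F t in at_right 0. a t \<noteq> 0"
    and "((\<lambda>t. of_real (t\<^sup>2) * Q / a t) \<longlongrightarrow> of_bool (P = 0 \<and> R = 0)) (at_right 0)"
    and "((\<lambda>t. of_real t * (R + of_real t * Q) / a t) \<longlongrightarrow> of_bool (P = 0)) (at_right 0)"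
proof -
  let ?F = "at_right (0::real)"
  let ?ratio1 = "\<lambda>t. of_real (t\<^sup>2) * Q / a t"
  let ?ratio2 = "\<lambda>t. of_real t * (R + of_real t * Q) / a t"
  have pos: "\<forall>\<^sub>F t in ?F. t > 0"
    by (simp add: eventually_at_right_less)
  have t0: "((\<lambda>t. of_real t) \<longlongrightarrow> (0::complex)) ?F"
    using tendsto_of_real[OF tendsto_ident_at, of 0 "{0<..}", where 'a = complex] by simp
  have linear: "((\<lambda>t. c + of_real t * d) \<longlongrightarrow> c) ?F" for c d :: complex
    using tendsto_add[OF tendsto_const[of c] tendsto_mult[OF t0 tendsto_const[of d]]] by simp
  have "(\<forall>\<^sub>F t in ?F. a t \<noteq> 0) \<and> (?ratio1 \<longlongrightarrow> of_bool (P = 0 \<and> R = 0)) ?F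
      \<and> (?ratio2 \<longlongrightarrow> of_bool (P = 0)) ?F"
  proof -
    consider "P \<noteq> 0" | "P = 0" "R \<noteq> 0" | "P = 0" "R = 0" "Q \<noteq> 0"
      using nz by blast
    then show ?thesis
    proof cases
      case 1
      have "(a \<longlongrightarrow> P + 0 * R + 0 * 0 * Q) ?F"
        unfolding a_def power2_eq_square of_real_mult by (intro tendsto_intros t0)
      then have a: "(a \<longlongrightarrow> P) ?F"
        by simp
      have "(?ratio1 \<longlongrightarrow> 0 * 0 * Q / P) ?F" "(?ratio2 \<longlongrightarrow> 0 * R / P) ?F"
        unfolding power2_eq_square of_real_mult
        using 1 by (intro tendsto_intros t0 a linear; simp)+
      then show ?thesis
        using 1 tendsto_imp_eventually_ne[OF a 1] by simp
    next
      case 2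
      have a: "a t = of_real t * (R + of_real t * Q)" for t
        by (simp add: a_def 2(1) algebra_simps power2_eq_square)
      have ne: "\<forall>\<^sub>F t in ?F. a t \<noteq> 0"
        using pos tendsto_imp_eventually_ne[OF linear 2(2)] by eventually_elim (simp add: a)
      have "((\<lambda>t. of_real t * Q / (R + of_real t * Q)) \<longlongrightarrow> 0 * Q / R) ?F"
        using 2(2) by (intro tendsto_intros t0 linear)
      then have "(?ratio1 \<longlongrightarrow> 0 * Q / R) ?F"
        by (rule Lim_transform_eventually)
          (use pos in \<open>eventually_elim; simp add: a power2_eq_square\<close>)
      moreover have "(?ratio2 \<longlongrightarrow> 1) ?F"
        by (rule Lim_transform_eventually[OF tendsto_const])
          (use ne in \<open>eventually_elim; simp add: a\<close>)
      ultimately show ?thesis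
        using 2 ne by simp
    next
      case 3
      have ne: "\<forall>\<^sub>F t in ?F. a t \<noteq> 0"
        using pos by eventually_elim (simp add: a_def 3)
      have "(?ratio1 \<longlongrightarrow> 1) ?F"
        by (rule Lim_transform_eventually[OF tendsto_const])
          (use pos in \<open>eventually_elim; simp add: a_def 3\<close>)
      moreover have "(?ratio2 \<longlongrightarrow> 1) ?F"
        by (rule Lim_transform_eventually[OF tendsto_const])
          (use pos in \<open>eventually_elim; simp add: a_def 3 power2_eq_square\<close>)
      ultimately show ?thesis
        using 3 ne by simp
    qed
  qed
  then show "\<forall>\<^sub>F t in ?F. a t \<noteq> 0"
    "(?ratio1 \<longlongrightarrow> of_bool (P = 0 \<and> R = 0)) ?F" "(?ratio2 \<longlongrightarrow> of_bool (P = 0)) ?F"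
    by blast+
qed

text \<open>
  In a finite-dimensional space every hyperplane has a normal vector, and linear forms are
  continuous; the second assumption replaces finite-dimensionality.
\<close>
locale dunkl_arrangement = hermitian h for h :: "'v::complex_normed \<Rightarrow> 'v \<Rightarrow> complex" +
  fixes \<H> :: "'v set set" and \<kappa> :: "'v set \<Rightarrow> complex" and \<Omega> :: "'v \<Rightarrow> 'v \<Rightarrow> 'v \<Rightarrow> 'v"
  assumes dunkl: "dunkl_form \<H> h \<kappa> \<Omega>"
    and ex_normal: "\<And>H. H \<in> \<H> \<Longrightarrow> \<exists>e. normal_to e H \<and> bounded_linear (\<lambda>x. h x e)"
begin

lemma finite_arrangement [simp]: "finite \<H>"
  using dunkl by (simp add: dunkl_form_def hyperplane_arrangement_def)

definition residue :: "'v set \<Rightarrow> 'v \<Rightarrow> 'v" where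
  "residue H s = \<kappa> H *\<^sub>C orth_proj_kernel h H s"

lemma residue_linear:
  assumes "H \<in> \<H>"
  shows "residue H (x + y) = residue H x + residue H y"
    and "residue H (c *\<^sub>C x) = c *\<^sub>C residue H x"
    and "residue H (sum f I) = (\<Sum>i\<in>I. residue H (f i))"
proof -
  obtain e where e: "normal_to e H"
    using ex_normal[OF assms] by blast
  have R: "residue H x = (\<kappa> H * (h x e / h e e)) *\<^sub>C e" for x
    by (simp add: residue_def orth_proj_kernel_normal[OF e] scaleC_scaleC)
  show add: "residue H (x + y) = residue H x + residue H y" for x y
    by (simp add: R add_divide_distrib distrib_left scaleC_add_left)
  show "residue H (c *\<^sub>C x) = c *\<^sub>C residue H x"
    by (simp add: R scaleC_scaleC mult_ac)
  have "residue H 0 = 0"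
    by (simp add: R)
  then show "residue H (sum f I) = (\<Sum>i\<in>I. residue H (f i))"
    by (induction I rule: infinite_finite_induct) (simp_all add: add)
qed

lemma dunkl_value:
  "z \<in> arrangement_complement \<H> \<Longrightarrow> \<Omega> z u v = (\<Sum>H\<in>\<H>. log_form H z u *\<^sub>C residue H v)"
  using dunkl by (simp add: dunkl_form_def residue_def)

lemma open_complement: "open (arrangement_complement \<H>)"
proof -
  have "closed H" if H: "H \<in> \<H>" for H
  proof -
    obtain e where e: "normal_to e H" "bounded_linear (\<lambda>x. h x e)"
      using ex_normal[OF H] by blast
    have "closed {x. h x e = 0}"
      using e(2) by (intro closed_Collect_eq continuous_intros linear_continuous_on)
    then show ?thesis
      using e(1) by (simp add: normal_to_def)
  qed
  then show ?thesis
    by (simp add: arrangement_complement_def open_Diff closed_Union)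
qed

text \<open>
  The derivative is symmetric in \<open>u\<close> and \<open>v\<close>, that is, \<open>\<omega>\<^sub>H\<close> is closed.
\<close>
lemma has_derivative_log_form:
  assumes "H \<in> \<H>" "z \<in> arrangement_complement \<H>"
  shows "((\<lambda>z. log_form H z v) has_derivative (\<lambda>u. - log_form H z v * log_form H z u)) (at z)"
proof -
  obtain e where e: "normal_to e H" "bounded_linear (\<lambda>x. h x e)"
    using ex_normal[OF assms(1)] by blast
  have z: "h z e \<noteq> 0" "z \<notin> H"
    using assms e(1) by (auto simp: arrangement_complement_def normal_to_def)
  have "((\<lambda>z. h v e / h z e) has_derivative (\<lambda>u. - log_form H z v * log_form H z u)) (at z)"
    using z
    by (auto intro!: derivative_eq_intros bounded_linear.has_derivative[OF e(2)]
        simp: log_form_normal[OF e(1)] field_simps)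
  then show ?thesis
    by (rule has_derivative_transform_within_open[OF _ open_complement assms(2)])
      (use assms(1) in \<open>auto simp: log_form_normal[OF e(1)] arrangement_complement_def\<close>)
qed

text \<open>
  The curvature is evaluated on constant vector fields.  Their Lie bracket vanishes, and the terms
  that contain a derivative of \<open>\<Omega>\<close> cancel since the logarithmic forms are closed.
\<close>
lemma dunkl_commute:
  assumes z: "z \<in> arrangement_complement \<H>"
  shows "\<Omega> z u (\<Omega> z v s) = \<Omega> z v (\<Omega> z u s)"
proof -
  let ?U = "arrangement_complement \<H>"
  have \<Omega>_minus: "\<Omega> z u (- x) = - \<Omega> z u x" for u x
    unfolding dunkl_value[OF z] sum_negf[symmetric]
    using residue_linear(2)[of _ "-1" x]
    by (intro sum.cong) (simp_all add: scaleC_one)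
  have \<Omega>_zero: "\<Omega> z 0 x = 0" for x
  proof -
    have "log_form H z 0 = 0" if "H \<in> \<H>" for H
      using ex_normal[OF that] z that by (auto simp: log_form_normal arrangement_complement_def)
    then show ?thesis
      by (simp add: dunkl_value[OF z])
  qed
  have D: "frechet_derivative (\<lambda>z. - \<Omega> z v s) (at z)
      = (\<lambda>u. - (\<Sum>H\<in>\<H>. (- log_form H z v * log_form H z u) *\<^sub>C residue H s))" for v
  proof (rule frechet_derivative_at[symmetric])
    have "((\<lambda>z. - (\<Sum>H\<in>\<H>. log_form H z v *\<^sub>C residue H s)) has_derivative
       (\<lambda>u. - (\<Sum>H\<in>\<H>. (- log_form H z v * log_form H z u) *\<^sub>C residue H s))) (at z)"
      by (intro derivative_intros has_derivative_log_form z
          bounded_linear.has_derivative[OF bounded_bilinear.bounded_linear_left[OF bounded_bilinear_scaleC]])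
    then show "((\<lambda>z. - \<Omega> z v s) has_derivative
       (\<lambda>u. - (\<Sum>H\<in>\<H>. (- log_form H z v * log_form H z u) *\<^sub>C residue H s))) (at z)"
      by (rule has_derivative_transform_within_open[OF _ open_complement z])
        (simp add: dunkl_value)
  qed
  have cov: "covariant_derivative \<Omega> (\<lambda>_. v) (\<lambda>_. s) = (\<lambda>z. - \<Omega> z v s)" for v
    by (simp add: fun_eq_iff covariant_derivative_def)
  have const: "holomorphic_field (\<lambda>_. x) ?U" for x :: 'v
    unfolding holomorphic_field_def by (auto intro!: exI[of _ "\<lambda>_. 0"])
  have "flat_connection_on ?U \<Omega>"
    using dunkl by (simp add: dunkl_form_def)
  then have "curvature \<Omega> (\<lambda>_. u) (\<lambda>_. v) (\<lambda>_. s) z = 0"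
    unfolding flat_connection_on_def using open_complement const z by blast
  then show ?thesis
    unfolding curvature_def cov
    by (simp add: covariant_derivative_def lie_bracket_def D \<Omega>_minus \<Omega>_zero mult.commute)
qed

lemma dunkl_square:
  assumes "z \<in> arrangement_complement \<H>"
  shows "\<Omega> z u (\<Omega> z v s)
    = (\<Sum>J\<in>\<H>. \<Sum>K\<in>\<H>. (log_form J z u * log_form K z v) *\<^sub>C residue J (residue K s))"
proof -
  have "residue J (\<Sum>K\<in>\<H>. log_form K z v *\<^sub>C residue K s)
      = (\<Sum>K\<in>\<H>. log_form K z v *\<^sub>C residue J (residue K s))" if "J \<in> \<H>" for J
    by (simp only: residue_linear(2,3)[OF that])
  then show ?thesis
    by (simp add: dunkl_value[OF assms] scaleC_sum_right scaleC_scaleC)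
qed

text \<open>
  On the curve \<open>z(t) = p + t r + t\<^sup>2 q\<close> an equation of \<open>K\<close> vanishes to order \<open>0\<close> in \<open>t\<close> if \<open>K\<close> does not
  contain \<open>p\<close>, to order \<open>2\<close> if \<open>K = H\<close>, and to order \<open>1\<close> otherwise.  Consequently \<open>t\<^sup>2 \<Omega>\<close>, evaluated at
  \<open>z(t)\<close> on the vector \<open>q\<close>, tends to the residue along \<open>H\<close>.  On the vector \<open>v(t) = (z(t) - p) / t\<close>, all
  forms \<open>\<omega>\<^sub>K\<close> with \<open>p \<in> K\<close> take the value \<open>1 / t\<close>, so that \<open>t \<Omega>\<close> tends to the sum of the residues along
  the hyperplanes through \<open>p\<close>.  Limits of commuting endomorphisms commute.
\<close>
lemma residue_commute:
  assumes H: "H \<in> \<H>" "p \<in> H" "r \<in> H"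
    and generic: "\<And>K. K \<in> \<H> \<Longrightarrow> p \<in> K \<Longrightarrow> K \<noteq> H \<Longrightarrow> r \<notin> K"
  shows "residue H (\<Sum>K | K \<in> \<H> \<and> p \<in> K. residue K s)
    = (\<Sum>K | K \<in> \<H> \<and> p \<in> K. residue K (residue H s))"
proof -
  obtain q where q: "normal_to q H"
    using ex_normal[OF H(1)] by blast
  have Hq: "q \<notin> H"
    using q by (auto simp: normal_to_def)
  let ?U = "arrangement_complement \<H>"
  let ?F = "at_right (0::real)"
  define z where "z t = p + t *\<^sub>R r + t\<^sup>2 *\<^sub>R q" for t :: real
  define v where "v t = r + t *\<^sub>R q" for t :: real
  define f where "f K t = of_real (t\<^sup>2) * log_form K (z t) q" for K t
  define g where "g K t = of_real t * log_form K (z t) (v t)" for K t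
  have lim: "(\<forall>\<^sub>F t in ?F. z t \<notin> K) \<and> (f K \<longlongrightarrow> of_bool (K = H)) ?F
      \<and> (g K \<longlongrightarrow> of_bool (p \<in> K)) ?F" if K: "K \<in> \<H>" for K
  proof -
    obtain e where e: "normal_to e K"
      using ex_normal[OF K] by blast
    define P R Q where "P = h p e" and "R = h r e" and "Q = h q e"
    have mem: "x \<in> K \<longleftrightarrow> h x e = 0" for x
      using e by (auto simp: normal_to_def)
    have hz: "h (z t) e = P + of_real t * R + of_real (t\<^sup>2) * Q" for t
      by (simp add: z_def P_def R_def Q_def)
    have nz: "P \<noteq> 0 \<or> R \<noteq> 0 \<or> Q \<noteq> 0"
      using generic[OF K] Hq mem[of p] mem[of q] mem[of r] unfolding P_def R_def Q_def by metis
    have PR: "P = 0 \<and> R = 0 \<longleftrightarrow> K = H" and P: "P = 0 \<longleftrightarrow> p \<in> K"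
      using generic[OF K] H unfolding mem[symmetric] P_def R_def by blast+
    have ne: "\<forall>\<^sub>F t in ?F. z t \<notin> K"
      unfolding mem hz by (rule parabola_limits(1)[OF nz])
    have "(f K \<longlongrightarrow> of_bool (P = 0 \<and> R = 0)) ?F"
      by (rule Lim_transform_eventually[OF parabola_limits(2)[OF nz]])
        (use ne in \<open>eventually_elim; simp add: f_def log_form_normal[OF e] hz Q_def\<close>)
    moreover have "(g K \<longlongrightarrow> of_bool (P = 0)) ?F"
      by (rule Lim_transform_eventually[OF parabola_limits(3)[OF nz]])
        (use ne in \<open>eventually_elim; simp add: g_def log_form_normal[OF e] hz v_def Q_def R_def\<close>)
    ultimately show ?thesis
      using ne unfolding PR by (simp add: P)
  qed
  have "\<forall>\<^sub>F t in ?F. \<forall>K\<in>\<H>. z t \<notin> K"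
    using lim by (simp add: eventually_ball_finite)
  then have U: "\<forall>\<^sub>F t in ?F. z t \<in> ?U"
    by eventually_elim (auto simp: arrangement_complement_def)
  define X where "X J K = residue J (residue K s)" for J K
  \<comment> \<open>Both sides are \<open>t\<^sup>3\<close> times a product of two values of \<open>\<Omega>\<close>, in the two possible orders.\<close>
  have eq: "\<forall>\<^sub>F t in ?F. (\<Sum>J\<in>\<H>. \<Sum>K\<in>\<H>. (f J t * g K t) *\<^sub>C X J K)
      = (\<Sum>J\<in>\<H>. \<Sum>K\<in>\<H>. (g J t * f K t) *\<^sub>C X J K)"
    using U
  proof eventually_elim
    case (elim t)
    have "(\<Sum>J\<in>\<H>. \<Sum>K\<in>\<H>. (f J t * g K t) *\<^sub>C X J K)
        = of_real (t\<^sup>2 * t) *\<^sub>C \<Omega> (z t) q (\<Omega> (z t) (v t) s)"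
      unfolding dunkl_square[OF elim] scaleC_sum_right scaleC_scaleC
      by (intro sum.cong refl) (simp add: f_def g_def X_def mult_ac)
    also have "\<dots> = of_real (t\<^sup>2 * t) *\<^sub>C \<Omega> (z t) (v t) (\<Omega> (z t) q s)"
      by (subst dunkl_commute[OF elim]) simp
    also have "\<dots> = (\<Sum>J\<in>\<H>. \<Sum>K\<in>\<H>. (g J t * f K t) *\<^sub>C X J K)"
      unfolding dunkl_square[OF elim] scaleC_sum_right scaleC_scaleC
      by (intro sum.cong refl) (simp add: f_def g_def X_def mult_ac)
    finally show ?case .
  qed
  have fg: "((\<lambda>t. \<Sum>J\<in>\<H>. \<Sum>K\<in>\<H>. (f J t * g K t) *\<^sub>C X J K) \<longlongrightarrow>
      (\<Sum>J\<in>\<H>. \<Sum>K\<in>\<H>. (of_bool (J = H) * of_bool (p \<in> K)) *\<^sub>C X J K)) ?F"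
    using lim by (intro tendsto_sum bounded_bilinear.tendsto[OF bounded_bilinear_scaleC] tendsto_mult tendsto_const) auto
  have gf: "((\<lambda>t. \<Sum>J\<in>\<H>. \<Sum>K\<in>\<H>. (g J t * f K t) *\<^sub>C X J K) \<longlongrightarrow>
      (\<Sum>J\<in>\<H>. \<Sum>K\<in>\<H>. (of_bool (p \<in> J) * of_bool (K = H)) *\<^sub>C X J K)) ?F"
    using lim by (intro tendsto_sum bounded_bilinear.tendsto[OF bounded_bilinear_scaleC] tendsto_mult tendsto_const) auto
  have limits: "(\<Sum>J\<in>\<H>. \<Sum>K\<in>\<H>. (of_bool (J = H) * of_bool (p \<in> K)) *\<^sub>C X J K)
      = (\<Sum>J\<in>\<H>. \<Sum>K\<in>\<H>. (of_bool (p \<in> J) * of_bool (K = H)) *\<^sub>C X J K)"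
    by (rule tendsto_unique[OF trivial_limit_at_right_real Lim_transform_eventually[OF fg eq] gf])
  have bool: "of_bool b *\<^sub>C x = (if b then x else 0)" for b and x :: 'v
    by (simp add: scaleC_one)
  have "(\<Sum>J\<in>\<H>. \<Sum>K\<in>\<H>. (of_bool (J = H) * of_bool (p \<in> K)) *\<^sub>C X J K)
      = (\<Sum>J\<in>\<H>. if J = H then \<Sum>K\<in>\<H>. of_bool (p \<in> K) *\<^sub>C X H K else 0)"
    by (intro sum.cong refl) auto
  also have "\<dots> = (\<Sum>K | K \<in> \<H> \<and> p \<in> K. X H K)"
    using H(1) by (simp add: bool sum.inter_filter del: of_bool_eq)
  also have "\<dots> = residue H (\<Sum>K | K \<in> \<H> \<and> p \<in> K. residue K s)"
    by (simp add: residue_linear(3)[OF H(1)] X_def)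
  finally have 1: "(\<Sum>J\<in>\<H>. \<Sum>K\<in>\<H>. (of_bool (J = H) * of_bool (p \<in> K)) *\<^sub>C X J K) = \<dots>" .
  have "(\<Sum>J\<in>\<H>. \<Sum>K\<in>\<H>. (of_bool (p \<in> J) * of_bool (K = H)) *\<^sub>C X J K)
      = (\<Sum>J\<in>\<H>. \<Sum>K\<in>\<H>. if K = H then of_bool (p \<in> J) *\<^sub>C X J H else 0)"
    by (intro sum.cong refl) auto
  also have "\<dots> = (\<Sum>K | K \<in> \<H> \<and> p \<in> K. residue K (residue H s))"
    using H(1) by (simp add: bool sum.inter_filter X_def del: of_bool_eq)
  finally show ?thesis
    using 1 limits by simp
qed

end

section \<open>Hermitian inner products on the reflection representation\<close>

lemma coord_diff_proj [simp]: "coord_diff i j (proj_type_A z) = z $ i - z $ j"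
  by (simp add: coord_diff.abs_eq)

lemma coord_diff_add_chain: "coord_diff i j x + coord_diff j k x = coord_diff i k x"
  by transfer simp

lemma type_A_eqI:
  assumes "\<And>k. coord_diff k i x = coord_diff k i y"
  shows "x = y"
  using assms
proof (induction x rule: type_A.abs_induct, induction y rule: type_A.abs_induct)
  case (1 y x)
  then have "x - y = vec (x $ i - y $ i)"
    by (simp add: vec_eq_iff algebra_simps)
  then show ?case
    unfolding proj_type_A_eq_iff by blast
qed

lemma proj_type_A_sum: "proj_type_A (sum f I) = (\<Sum>i\<in>I. proj_type_A (f i))"
  by (induction I rule: infinite_finite_induct)
    (simp_all add: proj_type_A_add zero_type_A.abs_eq)

lemma bounded_linear_coord_diff: "bounded_linear (coord_diff i j :: 'n::finite type_A \<Rightarrow> complex)"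
proof (rule bounded_linear_intro[where K = 2])
  fix x y :: "'n type_A" and r :: real
  show "coord_diff i j (x + y) = coord_diff i j x + coord_diff i j y"
    by transfer simp
  show "coord_diff i j (r *\<^sub>R x) = r *\<^sub>R coord_diff i j x"
    unfolding scaleR_scaleC by transfer (simp add: scaleR_conv_of_real algebra_simps)
  show "norm (coord_diff i j x) \<le> norm x * 2"
  proof transfer
    fix x :: "complex ^ 'n" and i j
    have "norm (x $ i - x $ j) = norm (centre x $ i - centre x $ j)"
      by (simp add: centre_def)
    also have "\<dots> \<le> norm (centre x $ i) + norm (centre x $ j)"
      by (rule norm_triangle_ineq4)
    also have "\<dots> \<le> norm (centre x) * 2"
      using Finite_Cartesian_Product.norm_nth_le[of "centre x"]
      by (metis add_mono mult_2_right)
    finally show "norm (x $ i - x $ j) \<le> norm (centre x) * 2" .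
  qed
qed

lemma ex_third:
  assumes "CARD('n::finite) \<ge> 3"
  shows "\<exists>k :: 'n. k \<noteq> i \<and> k \<noteq> j"
proof (rule ccontr)
  assume "\<nexists>k. k \<noteq> i \<and> k \<noteq> j"
  then have "UNIV = {i, j}"
    by blast
  moreover have "card {i, j} \<le> 2"
    by (simp add: card_insert_if)
  ultimately show False
    using assms by simp
qed

locale hermitian_type_A = hermitian h for h :: "'n::finite type_A \<Rightarrow> 'n type_A \<Rightarrow> complex"
begin

text \<open>
  A Riesz representation, obtained by counting dimensions in \<open>the coordinate space\<close>.  The map \<open>z \<mapsto> (h z b\<^sub>k)\<^sub>k\<close>, where \<open>b\<^sub>k\<close> is the
  class of the \<open>k\<close>-th unit vector, vanishes on the diagonal and takes values with coordinate sum \<open>0\<close>.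
  Adding the coordinate sum of \<open>z\<close> to every coordinate makes it injective, hence surjective.
\<close>
lemma coord_diff_representable: "\<exists>e. \<forall>x. h x e = coord_diff i j x"
proof -
  define b :: "'n \<Rightarrow> 'n type_A" where "b k = proj_type_A (axis k 1)" for k
  have proj: "proj_type_A z = (\<Sum>k\<in>UNIV. (z $ k) *\<^sub>C b k)" for z
  proof -
    have "z = (\<Sum>k\<in>UNIV. (z $ k) *s axis k 1)"
      by (simp add: vec_eq_iff axis_def if_distrib cong: if_cong)
    then show ?thesis
      by (metis (no_types, lifting) b_def proj_type_A_scale proj_type_A_sum sum.cong)
  qed
  have proj_vec: "proj_type_A (vec c) = 0" for c :: complex
    by (auto simp: zero_type_A.abs_eq proj_type_A_eq_iff intro: exI[of _ c])
  define T :: "complex ^ 'n \<Rightarrow> complex ^ 'n"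
    where "T z = (\<chi> k. h (proj_type_A z) (b k) + (\<Sum>l\<in>UNIV. z $ l))" for z
  have T_sum: "(\<Sum>k\<in>UNIV. T z $ k) = of_nat CARD('n) * (\<Sum>l\<in>UNIV. z $ l)" for z
  proof -
    have "(\<Sum>k\<in>UNIV. h (proj_type_A z) (b k)) = h (proj_type_A z) (proj_type_A (vec 1))"
      unfolding proj[of "vec 1"] sum_right by simp
    also have "\<dots> = 0"
      unfolding proj_vec by simp
    finally show ?thesis
      by (simp add: T_def sum.distrib)
  qed
  have T_linear: "Vector_Spaces.linear (*s) (*s) T"
    by unfold_locales
      (simp_all add: vec_eq_iff T_def proj_type_A_add proj_type_A_scale sum.distrib
        sum_distrib_left algebra_simps)
  have "z = 0" if "T z = 0" for z
  proof -
    have s: "(\<Sum>l\<in>UNIV. z $ l) = 0"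
      using T_sum[of z] that by simp
    then have *: "h (proj_type_A z) (b k) = 0" for k
      using arg_cong[OF that, of "\<lambda>x. x $ k"] by (simp add: T_def)
    have "h (proj_type_A z) (proj_type_A z) = 0"
      by (subst (2) proj) (simp add: sum_right *)
    then have "proj_type_A z = proj_type_A 0"
      by (simp add: zero_type_A.abs_eq)
    then obtain c where "z = vec c"
      by (auto simp: proj_type_A_eq_iff)
    then show ?thesis
      using s by simp
  qed
  then have "inj T"
    using vec.linear_inj_iff_eq_0[OF T_linear] by blast
  then have "surj T"
    by (rule vec.linear_inj_imp_surj[OF T_linear])
  then obtain z where z: "T z = (\<chi> k. of_bool (k = i) - of_bool (k = j))"
    by (metis surjD)
  have "(\<Sum>l\<in>UNIV. z $ l) = 0"
    using T_sum[of z] by (simp add: z sum_subtractf)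
  then have hb: "h (proj_type_A z) (b k) = of_bool (k = i) - of_bool (k = j)" for k
    using arg_cong[OF z, of "\<lambda>x. x $ k"] by (simp add: T_def)
  have "h (proj_type_A y) (proj_type_A z) = coord_diff i j (proj_type_A y)" for y
  proof -
    have "h (proj_type_A z) (proj_type_A y)
        = (\<Sum>k\<in>UNIV. cnj (y $ k) * of_bool (k = i)) - (\<Sum>k\<in>UNIV. cnj (y $ k) * of_bool (k = j))"
      unfolding proj[of y] sum_right scaleC_right hb sum_subtractf[symmetric]
      by (simp add: algebra_simps)
    also have "\<dots> = cnj (y $ i) - cnj (y $ j)"
      by simp
    finally show ?thesis
      by (metis commute complex_cnj_diff complex_cnj_cnj coord_diff_proj)
  qed
  then have "h x (proj_type_A z) = coord_diff i j x" for x
    by (induction x rule: type_A.abs_induct)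
  then show ?thesis
    by blast
qed

definition root_vector :: "'n \<Rightarrow> 'n \<Rightarrow> 'n type_A" where
  "root_vector i j = (SOME e. \<forall>x. h x e = coord_diff i j x)"

lemma root_vector [simp]: "h x (root_vector i j) = coord_diff i j x"
  using someI_ex[OF coord_diff_representable[of i j]] by (simp add: root_vector_def)

lemma root_vector_swap: "root_vector j i = - root_vector i j"
  using coord_diff_add_chain[of i j _ i] coord_diff_add_chain[of i i _ i]
  by (intro eqI_right) (simp add: eq_neg_iff_add_eq_0 add.commute)

lemma root_vector_add: "root_vector i j + root_vector j k = root_vector i k"
  by (intro eqI_right) (simp add: coord_diff_add_chain)

lemma root_vector_nonzero:
  assumes "i \<noteq> j"
  shows "root_vector i j \<noteq> 0"
proof
  assume "root_vector i j = 0"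
  then have "coord_diff i j (proj_type_A (axis i 1)) = 0"
    by (metis root_vector zero_right)
  then show False
    using assms by (simp add: axis_def)
qed

lemma normal_root_vector: "i \<noteq> j \<Longrightarrow> normal_to (root_vector i j) (root_hyperplane i j)"
  by (simp add: normal_to_def root_vector_nonzero root_hyperplane_def)

subsection \<open>Recognizing Lauricella inner products\<close>

text \<open>
  The inner products of root vectors sharing one index determine \<open>h\<close>.  They identify \<open>root_vector i j\<close>
  as the class of an explicit coordinate vector \<open>f\<^sub>i\<^sub>j\<close> (step \<open>root\<close>).  A vector \<open>z\<close> of the hyperplane
  \<open>\<Sum>\<^sub>i \<mu>\<^sub>i z\<^sub>i = 0\<close> is the combination \<open>\<Sum>\<^sub>i \<mu>\<^sub>i z\<^sub>i f\<^sub>i\<^sub>m\<close>, for any fixed index \<open>m\<close>; as \<open>h\<close> pairs \<open>root_vector i m\<close> with \<open>y\<close> to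
  \<open>y\<^sub>i - y\<^sub>m\<close>, this computes \<open>h\<close> in coordinates (step \<open>h_proj\<close>).  All claims about \<open>\<mu>\<close> follow from that
  formula.
\<close>
lemma lauricella_of_gram:
  fixes lam :: "'n \<Rightarrow> real"
  assumes card: "CARD('n) \<ge> 3"
    and nz: "\<And>i. lam i \<noteq> 0"
    and gram: "\<And>i j k. i \<noteq> j \<Longrightarrow> i \<noteq> k \<Longrightarrow> j \<noteq> k \<Longrightarrow>
      h (root_vector i j) (root_vector i k) = of_real (lam i)"
  defines "\<mu> \<equiv> \<lambda>i. 1 / lam i"
  shows norm_root_vector: "i \<noteq> j \<Longrightarrow> h (root_vector i j) (root_vector i j) = of_real (lam i + lam j)"
    and "lauricella_weights \<mu>"
    and "lauricella_inner \<mu> = h"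
proof -
  show norm: "h (root_vector i j) (root_vector i j) = of_real (lam i + lam j)" if ij: "i \<noteq> j" for i j
  proof -
    obtain k where k: "k \<noteq> i" "k \<noteq> j"
      using ex_third[OF card] by blast
    have "h (root_vector i j) (root_vector i k + root_vector k j)
        = h (root_vector i j) (root_vector i k) + h (root_vector j i) (root_vector j k)"
      by (simp add: root_vector_swap[of i j] root_vector_swap[of k j] del: root_vector)
    then have "h (root_vector i j) (root_vector i j)
        = h (root_vector i j) (root_vector i k) + h (root_vector j i) (root_vector j k)"
      unfolding root_vector_add .
    then show ?thesis
      using ij k by (simp add: gram del: root_vector)
  qed
  have root: "root_vector i j = proj_type_A (of_real (lam i) *s axis i 1 - of_real (lam j) *s axis j 1)"
    (is "_ = proj_type_A ?w") for i j
  proof (cases "i = j")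
    case True
    have "root_vector i i = 0"
      using root_vector_add[of i i i] by simp
    then show ?thesis
      using True by (simp add: zero_type_A.abs_eq)
  next
    case False
    show ?thesis
    proof (rule type_A_eqI[where i = i])
      fix k
      have "coord_diff k i (root_vector i j) = - h (root_vector i j) (root_vector i k)"
        using root_vector_swap[of k i] by (metis root_vector minus_right)
      also have "\<dots> = coord_diff k i (proj_type_A ?w)"
      proof -
        consider "k = i" | "k = j" | "k \<noteq> i" "k \<noteq> j"
          by blast
        then show ?thesis
        proof cases
          case 1
          then show ?thesis
            using root_vector_add[of i i i] by (simp del: root_vector)
        next
          case 2
          then show ?thesis
            using False by (simp add: norm axis_def del: root_vector)
        next
          case 3
          then show ?thesis
            using False by (simp add: gram axis_def del: root_vector)
        qed
      qed
      finally show "coord_diff k i (root_vector i j) = coord_diff k i (proj_type_A ?w)" .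
    qed
  qed
  have h_proj: "h (proj_type_A y) (proj_type_A z) = (\<Sum>i\<in>UNIV. of_real (\<mu> i) * y $ i * cnj (z $ i))"
    if z: "(\<Sum>i\<in>UNIV. of_real (\<mu> i) * z $ i) = 0" for y z :: "complex ^ 'n"
  proof -
    fix m :: 'n
    have "z = (\<Sum>i\<in>UNIV. (of_real (\<mu> i) * z $ i) *s
        (of_real (lam i) *s axis i 1 - of_real (lam m) *s axis m 1))" (is "z = ?sum")
    proof -
      have "?sum $ k = z $ k" for k
      proof -
        have "?sum $ k = (\<Sum>i\<in>UNIV. of_bool (k = i) * z $ i)
            - (\<Sum>i\<in>UNIV. of_real (\<mu> i) * z $ i) * (of_real (lam m) * of_bool (k = m))"
          unfolding sum_distrib_right sum_subtractf[symmetric] sum_component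
          by (intro sum.cong refl) (use nz in \<open>simp add: axis_def \<mu>_def field_simps\<close>)
        then show ?thesis
          using z by simp
      qed
      then show ?thesis
        by (simp add: vec_eq_iff)
    qed
    then have "proj_type_A z = (\<Sum>i\<in>UNIV. (of_real (\<mu> i) * z $ i) *\<^sub>C root_vector i m)"
      unfolding root by (metis (no_types, lifting) proj_type_A_scale proj_type_A_sum sum.cong)
    then have "h (proj_type_A y) (proj_type_A z)
        = (\<Sum>i\<in>UNIV. of_real (\<mu> i) * y $ i * cnj (z $ i)) - cnj (\<Sum>i\<in>UNIV. of_real (\<mu> i) * z $ i) * y $ m"
      by (simp add: sum_right sum_distrib_left sum_subtractf algebra_simps)
    then show ?thesis
      using z by simp
  qed
  have \<mu>: "\<mu> i \<noteq> 0" for i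
    using nz by (simp add: \<mu>_def)
  show weights: "lauricella_weights \<mu>"
    unfolding lauricella_weights_def
  proof (intro conjI allI impI)
    fix z :: "complex ^ 'n"
    assume z: "(\<Sum>i\<in>UNIV. of_real (\<mu> i) * z $ i) = 0 \<and> z \<noteq> 0"
    \<comment> \<open>\<open>h_proj\<close> recovers \<open>z\<close> from its class, by pairing that class with the unit vectors.\<close>
    have "proj_type_A z \<noteq> 0"
    proof
      assume "proj_type_A z = 0"
      then have "(\<Sum>i\<in>UNIV. of_real (\<mu> i) * y $ i * cnj (z $ i)) = 0" for y
        using h_proj[of z y] z by simp
      from this[of "axis _ 1"] have "of_real (\<mu> k) * cnj (z $ k) = 0" for k
        by (simp add: axis_def if_distrib if_distribR cong: if_cong)
      then show False
        using z \<mu> by (simp add: vec_eq_iff)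
    qed
    then have "0 < Re (h (proj_type_A z) (proj_type_A z))"
      by (rule positive)
    also have "\<dots> = (\<Sum>i\<in>UNIV. \<mu> i * (cmod (z $ i))\<^sup>2)"
      using z by (simp add: h_proj mult.assoc complex_norm_square[symmetric] flip: of_real_power)
    finally show "0 < (\<Sum>i\<in>UNIV. \<mu> i * (cmod (z $ i))\<^sup>2)" .
  qed (rule \<mu>)
  \<comment> \<open>Otherwise the diagonal would be isotropic inside the hyperplane.\<close>
  have total: "(\<Sum>i\<in>UNIV. of_real (\<mu> i)) \<noteq> (0 :: complex)"
  proof
    assume *: "(\<Sum>i\<in>UNIV. of_real (\<mu> i)) = (0 :: complex)"
    then have "(\<Sum>i\<in>UNIV. \<mu> i) = 0"
      by (metis of_real_eq_0_iff of_real_sum)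
    moreover have "(vec 1 :: complex ^ 'n) \<noteq> 0"
      by (simp add: vec_eq_iff)
    ultimately show False
      using weights * unfolding lauricella_weights_def
      by (auto dest!: spec[of _ "vec 1 :: complex ^ 'n"])
  qed
  have lift: "proj_type_A (lauricella_lift \<mu> x) = x \<and> (\<Sum>i\<in>UNIV. of_real (\<mu> i) * lauricella_lift \<mu> x $ i) = 0"
    for x
    unfolding lauricella_lift_def
  proof (rule theI')
    obtain z where z: "proj_type_A z = x"
      by (induction x rule: type_A.abs_induct) blast
    let ?S = "\<lambda>z :: complex ^ 'n. \<Sum>i\<in>UNIV. of_real (\<mu> i) * z $ i"
    let ?M = "\<Sum>i\<in>UNIV. of_real (\<mu> i) :: complex"
    have S: "?S (z - vec c) = ?S z - ?M * c" for z c
      by (simp add: algebra_simps sum_subtractf sum_distrib_left)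
    show "\<exists>!z. proj_type_A z = x \<and> ?S z = 0"
    proof (rule ex1I)
      show "proj_type_A (z - vec (?S z / ?M)) = x \<and> ?S (z - vec (?S z / ?M)) = 0"
        unfolding S using total by (auto simp: z[symmetric] proj_type_A_eq_iff vec_eq_iff intro: exI[of _ "- (?S z / ?M)"])
    next
      fix w assume w: "proj_type_A w = x \<and> ?S w = 0"
      then obtain c where "z - w = vec c"
        using z by (metis proj_type_A_eq_iff)
      then have c: "w = z - vec c"
        by (simp add: algebra_simps)
      then show "w = z - vec (?S z / ?M)"
        using w S[of z c] total by (simp add: eq_divide_eq mult.commute)
    qed
  qed
  show "lauricella_inner \<mu> = h"
    using h_proj lift by (simp add: fun_eq_iff lauricella_inner_def) metis
qed

end

section \<open>Intersections of codimension two\<close>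

lemma root_hyperplane_swap: "root_hyperplane j i = root_hyperplane i j"
proof -
  have "coord_diff j i x = 0 \<longleftrightarrow> coord_diff i j x = 0" for x :: "'a type_A"
    by transfer auto
  then show ?thesis
    by (simp add: root_hyperplane_def)
qed

lemma proj_in_root_hyperplane [simp]: "proj_type_A z \<in> root_hyperplane i j \<longleftrightarrow> z $ i = z $ j"
  by (simp add: root_hyperplane_def)

lemma root_hyperplane_in_arrangement:
  fixes i j :: "'n::{finite,linorder}"
  assumes "i \<noteq> j"
  shows "root_hyperplane i j \<in> arrangement_A"
proof (cases "i < j")
  case True
  then show ?thesis
    by (auto simp: arrangement_A_def)
next
  case False
  then have "j < i"
    using assms by simp
  then show ?thesis
    using root_hyperplane_swap[of j i] by (auto simp: arrangement_A_def)
qed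

lemma root_hyperplane_eqD:
  assumes "root_hyperplane i j = root_hyperplane k l" "k \<noteq> l"
  shows "k \<in> {i, j}"
proof (rule ccontr)
  assume "k \<notin> {i, j}"
  then have "proj_type_A (axis k 1) \<in> root_hyperplane i j"
    by (auto simp: axis_def)
  then show False
    using assms by (simp add: axis_def)
qed

lemma root_hyperplane_eq_iff:
  assumes "i \<noteq> j" "k \<noteq> l"
  shows "root_hyperplane i j = root_hyperplane k l \<longleftrightarrow> {i, j} = {k, l}"
proof
  assume eq: "root_hyperplane i j = root_hyperplane k l"
  show "{i, j} = {k, l}"
    using root_hyperplane_eqD[OF eq] root_hyperplane_eqD[of i j l k] eq assms
      root_hyperplane_swap[of k l] by auto
qed (auto simp: doubleton_eq_iff root_hyperplane_swap)

text \<open>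
  A self-map \<open>r\<close> of the index set prescribes which coordinates of the point coincide.
\<close>
lemma generic_point:
  fixes r :: "'n::{finite,linorder} \<Rightarrow> 'n"
  obtains p :: "'n type_A"
  where "{K \<in> arrangement_A. p \<in> K} = (\<lambda>(a, b). root_hyperplane a b) ` {(a, b). a \<noteq> b \<and> r a = r b}"
proof -
  obtain f :: "'n \<Rightarrow> nat" where f: "inj f"
    using finite_imp_inj_to_nat_seg[of "UNIV :: 'n set"] by auto
  define p where "p = proj_type_A (\<chi> m. of_nat (f (r m)))"
  have p: "p \<in> root_hyperplane a b \<longleftrightarrow> r a = r b" for a b
    using f by (simp add: p_def inj_eq)
  have "{K \<in> arrangement_A. p \<in> K} = (\<lambda>(a, b). root_hyperplane a b) ` {(a, b). a \<noteq> b \<and> r a = r b}"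
  proof (intro equalityI subsetI)
    fix K
    assume K: "K \<in> {K \<in> arrangement_A. p \<in> K}"
    then obtain a b where "a < b" "K = root_hyperplane a b"
      by (auto simp: arrangement_A_def)
    with K p[of a b] show "K \<in> (\<lambda>(a, b). root_hyperplane a b) ` {(a, b). a \<noteq> b \<and> r a = r b}"
      by (intro image_eqI[of _ _ "(a, b)"]) auto
  next
    fix K
    assume "K \<in> (\<lambda>(a, b). root_hyperplane a b) ` {(a, b). a \<noteq> b \<and> r a = r b}"
    then obtain a b where "a \<noteq> b" "r a = r b" "K = root_hyperplane a b"
      by blast
    then show "K \<in> {K \<in> arrangement_A. p \<in> K}"
      using p[of a b] root_hyperplane_in_arrangement by simp
  qed
  then show thesis
    by (rule that)
qed

text \<open>
  In the next two lemmas the assumption \<open>comm\<close> is what remains of a commutation relation between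
  multiples of the projections \<open>s \<mapsto> h s a / h a a * a\<close>, and the vectors \<open>x\<close> and \<open>y\<close> serve to compare
  coefficients.
\<close>
lemma (in hermitian) commuting_pair_orthogonal:
  assumes dual: "h x a = 1" "h x b = 0"
    and comm: "\<And>s. (\<alpha> * h s b * h b a) *\<^sub>C a = (\<alpha> * h s a * h a b) *\<^sub>C b"
    and "\<alpha> \<noteq> 0"
  shows "h a b = 0"
proof -
  have "h ((\<alpha> * h x b * h b a) *\<^sub>C a) b = h ((\<alpha> * h x a * h a b) *\<^sub>C b) b"
    by (simp only: comm)
  then have "h a b = 0 \<or> h b b = 0"
    using dual assms(4) by simp
  then show ?thesis
    by auto
qed

text \<open>
  This is the case of three lines in a plane.  At \<open>s = x\<close>, comparing the coefficients of \<open>b\<close> gives the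
  first relation, and comparing those of \<open>a\<close> shows that \<open>h a c\<close> is real; so is \<open>h a b\<close>, as the sum of
  \<open>h a a\<close>, \<open>h a b\<close> and \<open>h a c\<close> is \<open>0\<close>.  If \<open>h a b\<close> vanished, then so would \<open>h a c\<close> and hence \<open>h a a\<close>.
\<close>
lemma (in hermitian) commuting_triple_gram:
  assumes abc: "c = - a - b"
    and dual: "h x a = 1" "h x b = 0" "h y a = 0" "h y b = 1"
    and nz: "\<alpha> \<noteq> 0" "\<gamma> \<noteq> 0"
    and comm: "\<And>s. (\<alpha> * \<beta> * h s b * h b a + \<alpha> * \<gamma> * h s c * h c a) *\<^sub>C a
      = (\<alpha> * \<beta> * h s a * h a b) *\<^sub>C b + (\<alpha> * \<gamma> * h s a * h a c) *\<^sub>C c"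
  shows "\<beta> * h a b = \<gamma> * h a c" "h b a = h a b" "h a b \<noteq> 0"
proof -
  have c: "h x c = - 1" "h y c = - 1"
    using dual by (simp_all add: abc)
  have "h y ((\<alpha> * \<beta> * h x b * h b a + \<alpha> * \<gamma> * h x c * h c a) *\<^sub>C a)
      = h y ((\<alpha> * \<beta> * h x a * h a b) *\<^sub>C b + (\<alpha> * \<gamma> * h x a * h a c) *\<^sub>C c)"
    by (simp only: comm)
  then have "cnj (\<alpha> * (\<beta> * h a b - \<gamma> * h a c)) = 0"
    unfolding add_right scaleC_right dual c by (auto simp: algebra_simps)
  then have "\<alpha> * (\<beta> * h a b - \<gamma> * h a c) = 0"
    by (simp only: complex_cnj_zero_iff)
  then show eq: "\<beta> * h a b = \<gamma> * h a c"
    using nz by simp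
  have "h x ((\<alpha> * \<beta> * h x b * h b a + \<alpha> * \<gamma> * h x c * h c a) *\<^sub>C a)
      = h x ((\<alpha> * \<beta> * h x a * h a b) *\<^sub>C b + (\<alpha> * \<gamma> * h x a * h a c) *\<^sub>C c)"
    by (simp only: comm)
  then have "cnj (\<alpha> * \<gamma> * (h c a - h a c)) = 0"
    unfolding add_right scaleC_right dual c by (simp add: algebra_simps)
  then have "\<alpha> * \<gamma> * (h c a - h a c) = 0"
    by (simp only: complex_cnj_zero_iff)
  then have "h c a = h a c"
    using nz by simp
  then show "h b a = h a b"
    by (simp add: abc)
  show "h a b \<noteq> 0"
  proof
    assume 0: "h a b = 0"
    then have "h a a = 0"
      using eq nz by (simp add: abc)
    then show False
      using dual(1) by simp
  qed
qed

section \<open>Dunkl forms of type A\<close>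

locale dunkl_type_A = hermitian_type_A h for h :: "'n::{finite,linorder} type_A \<Rightarrow> 'n type_A \<Rightarrow> complex" +
  fixes \<kappa> :: "'n type_A set \<Rightarrow> complex" and \<Omega> :: "'n type_A \<Rightarrow> 'n type_A \<Rightarrow> 'n type_A \<Rightarrow> 'n type_A"
  assumes dunkl_A: "dunkl_form arrangement_A h \<kappa> \<Omega>"
    and \<kappa>_nonzero: "\<And>i j. i \<noteq> j \<Longrightarrow> \<kappa> (root_hyperplane i j) \<noteq> 0"
    and card_ge_3: "CARD('n) \<ge> 3"

sublocale dunkl_type_A \<subseteq> dunkl_arrangement h arrangement_A \<kappa> \<Omega>
proof unfold_locales
  show "dunkl_form arrangement_A h \<kappa> \<Omega>"
    by (rule dunkl_A)
  fix H :: "'n type_A set"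
  assume "H \<in> arrangement_A"
  then obtain i j where "i < j" "H = root_hyperplane i j"
    by (auto simp: arrangement_A_def)
  then show "\<exists>e. normal_to e H \<and> bounded_linear (\<lambda>x. h x e)"
    using normal_root_vector[of i j] bounded_linear_coord_diff[of i j]
    by (intro exI[of _ "root_vector i j"]) auto
qed

context dunkl_type_A
begin

text \<open>
  The coefficient of the rank one form \<open>|z\<^sub>i - z\<^sub>j|\<^sup>2\<close> in the sesquilinear form that \<open>h\<close> associates with the
  endomorphism \<open>\<Sum>\<^sub>H \<kappa>\<^sub>H \<pi>\<^sub>H\<close>.
\<close>
definition weight :: "'n \<Rightarrow> 'n \<Rightarrow> complex" where
  "weight i j = \<kappa> (root_hyperplane i j) / h (root_vector i j) (root_vector i j)"

lemma weight_swap: "weight j i = weight i j"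
  by (simp add: weight_def root_hyperplane_swap[of i j] root_vector_swap[of i j] del: root_vector)

lemma weight_nonzero: "i \<noteq> j \<Longrightarrow> weight i j \<noteq> 0"
  by (simp add: weight_def \<kappa>_nonzero root_vector_nonzero del: root_vector)

lemma residue_root:
  assumes "i \<noteq> j"
  shows "residue (root_hyperplane i j) s = (weight i j * h s (root_vector i j)) *\<^sub>C root_vector i j"
  by (simp add: residue_def orth_proj_kernel_normal[OF normal_root_vector[OF assms]] weight_def
      scaleC_scaleC del: root_vector)

text \<open>
  A generic point of \<open>H\<^sub>i\<^sub>j \<inter> H\<^sub>k\<^sub>l\<close> lies on no other hyperplane, so the two projections commute; two
  distinct lines whose orthogonal projections commute are perpendicular.
\<close>
lemma root_vectors_orthogonal:
  assumes "i \<noteq> j" "k \<noteq> l" "{i, j} \<inter> {k, l} = {}"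
  shows "h (root_vector i j) (root_vector k l) = 0"
proof -
  let ?H = "root_hyperplane i j" and ?K = "root_hyperplane k l"
  have ne: "?H \<noteq> ?K"
    using assms by (simp add: root_hyperplane_eq_iff doubleton_eq_iff) blast
  have mem: "?H \<in> arrangement_A" "?K \<in> arrangement_A"
    using assms by (simp_all add: root_hyperplane_in_arrangement)
  define r where "r m = (if m = j then i else if m = l then k else m)" for m
  obtain p where p: "{K \<in> arrangement_A. p \<in> K} = (\<lambda>(a, b). root_hyperplane a b) ` {(a, b). a \<noteq> b \<and> r a = r b}"
    using generic_point[of r] by blast
  have "{(a, b). a \<noteq> b \<and> r a = r b} = {(i, j), (j, i), (k, l), (l, k)}"
    using assms by (auto simp: r_def split: if_splits)
  then have "{K \<in> arrangement_A. p \<in> K} = {?H, ?K}"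
    unfolding p using root_hyperplane_swap[of j i] root_hyperplane_swap[of l k] by auto
  then have pK: "{K. K \<in> arrangement_A \<and> p \<in> K} = {?H, ?K}"
    by simp
  have comm: "residue ?H (\<Sum>K\<in>{?H, ?K}. residue K s) = (\<Sum>K\<in>{?H, ?K}. residue K (residue ?H s))" for s
    unfolding pK[symmetric]
  proof (rule residue_commute)
    show "?H \<in> arrangement_A" "p \<in> ?H"
      using pK by auto
    show "proj_type_A (axis k 1) \<in> ?H"
      using assms by (auto simp: axis_def)
    fix K assume "K \<in> arrangement_A" "p \<in> K" "K \<noteq> ?H"
    then have "K = ?K"
      using pK by blast
    then show "proj_type_A (axis k 1) \<notin> K"
      using assms by (simp add: axis_def)
  qed
  then have comm': "residue ?H (residue ?K s) = residue ?K (residue ?H s)" for s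
    using ne by (simp add: residue_linear(1)[OF mem(1)])
  show ?thesis
  proof (rule commuting_pair_orthogonal)
    show "h (proj_type_A (axis i 1)) (root_vector i j) = 1"
      "h (proj_type_A (axis i 1)) (root_vector k l) = 0"
      using assms by (auto simp: axis_def)
    show "weight i j * weight k l \<noteq> 0"
      using assms by (simp add: weight_nonzero)
    show "(weight i j * weight k l * h s (root_vector k l) * h (root_vector k l) (root_vector i j)) *\<^sub>C root_vector i j
        = (weight i j * weight k l * h s (root_vector i j) * h (root_vector i j) (root_vector k l)) *\<^sub>C root_vector k l" for s
      using comm'[of s] assms by (simp add: residue_root mult_ac del: root_vector)
  qed
qed

text \<open>
  The hyperplanes through a generic point of \<open>z\<^sub>i = z\<^sub>j = z\<^sub>k\<close> are the three given by pairs of these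
  indices, and their root vectors, taken in cyclic order, add up to \<open>0\<close>.
\<close>
lemma triple_relations:
  assumes "i \<noteq> j" "j \<noteq> k" "i \<noteq> k"
  shows "weight j k * h (root_vector i j) (root_vector j k) = weight k i * h (root_vector i j) (root_vector k i)"
    and "h (root_vector j k) (root_vector i j) = h (root_vector i j) (root_vector j k)"
    and "h (root_vector i j) (root_vector j k) \<noteq> 0"
proof -
  let ?A = "root_hyperplane i j" and ?B = "root_hyperplane j k" and ?C = "root_hyperplane k i"
  have ne: "?A \<noteq> ?B" "?A \<noteq> ?C" "?B \<noteq> ?C"
    using assms by (simp_all add: root_hyperplane_eq_iff doubleton_eq_iff)
  have mem: "?A \<in> arrangement_A" "?B \<in> arrangement_A" "?C \<in> arrangement_A"
    using assms by (simp_all add: root_hyperplane_in_arrangement)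
  define r where "r m = (if m = j \<or> m = k then i else m)" for m
  obtain p where p: "{K \<in> arrangement_A. p \<in> K} = (\<lambda>(a, b). root_hyperplane a b) ` {(a, b). a \<noteq> b \<and> r a = r b}"
    using generic_point[of r] by blast
  have "{(a, b). a \<noteq> b \<and> r a = r b} = {(i, j), (j, i), (j, k), (k, j), (k, i), (i, k)}"
    using assms by (auto simp: r_def split: if_splits)
  then have "{K \<in> arrangement_A. p \<in> K} = {?A, ?B, ?C}"
    unfolding p
    using root_hyperplane_swap[of j i] root_hyperplane_swap[of k j] root_hyperplane_swap[of i k] by auto
  then have pK: "{K. K \<in> arrangement_A \<and> p \<in> K} = {?A, ?B, ?C}"
    by simp
  have comm: "residue ?A (\<Sum>K\<in>{?A, ?B, ?C}. residue K s) = (\<Sum>K\<in>{?A, ?B, ?C}. residue K (residue ?A s))" for s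
    unfolding pK[symmetric]
  proof (rule residue_commute)
    show "?A \<in> arrangement_A" "p \<in> ?A"
      using pK by auto
    show "proj_type_A (axis k 1) \<in> ?A"
      using assms by (simp add: axis_def)
    fix K assume "K \<in> arrangement_A" "p \<in> K" "K \<noteq> ?A"
    then have "K = ?B \<or> K = ?C"
      using pK by blast
    then show "proj_type_A (axis k 1) \<notin> K"
      using assms by (auto simp: axis_def)
  qed
  then have comm': "residue ?A (residue ?B s) + residue ?A (residue ?C s)
      = residue ?B (residue ?A s) + residue ?C (residue ?A s)" for s
    using ne by (simp add: residue_linear(1)[OF mem(1)])
  let ?a = "root_vector i j" and ?b = "root_vector j k" and ?c = "root_vector k i"
  have c: "?c = - ?a - ?b"
    unfolding root_vector_swap[of k i] root_vector_add[of i j k, symmetric] by simp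
  have dual: "h (proj_type_A (axis i 1)) ?a = 1" "h (proj_type_A (axis i 1)) ?b = 0"
    "h (- proj_type_A (axis k 1)) ?a = 0" "h (- proj_type_A (axis k 1)) ?b = 1"
    using assms unfolding minus_left by (auto simp: axis_def)
  have nz: "weight i j \<noteq> 0" "weight k i \<noteq> 0"
    using assms by (simp_all add: weight_nonzero)
  have comm'': "(weight i j * weight j k * h s ?b * h ?b ?a + weight i j * weight k i * h s ?c * h ?c ?a) *\<^sub>C ?a
      = (weight i j * weight j k * h s ?a * h ?a ?b) *\<^sub>C ?b
        + (weight i j * weight k i * h s ?a * h ?a ?c) *\<^sub>C ?c" for s
    using comm'[of s] assms by (simp add: residue_root scaleC_add_left mult_ac del: root_vector)
  show "weight j k * h ?a ?b = weight k i * h ?a ?c" "h ?b ?a = h ?a ?b" "h ?a ?b \<noteq> 0"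
    using commuting_triple_gram[OF c dual nz comm''] by blast+
qed

text \<open>
  The relations in triples make \<open>h (root_vector i j) (root_vector i k)\<close> real, hence symmetric in \<open>j\<close>
  and \<open>k\<close>, and orthogonality allows replacing \<open>k\<close> by any further index; together, these moves connect
  all admissible pairs \<open>(j, k)\<close>.  With three indices only, symmetry already suffices.
\<close>
lemma gram_invariants:
  obtains lam :: "'n \<Rightarrow> real"
  where "\<And>i. lam i \<noteq> 0"
    and "\<And>i j k. i \<noteq> j \<Longrightarrow> i \<noteq> k \<Longrightarrow> j \<noteq> k \<Longrightarrow>
      h (root_vector i j) (root_vector i k) = of_real (lam i)"
proof -
  define L where "L i j k = h (root_vector i j) (root_vector i k)" for i j k
  have L: "L i j k = - h (root_vector j i) (root_vector i k)" for i j k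
    by (simp add: L_def root_vector_swap[of i j] del: root_vector)
  have sym: "L i k j = L i j k" and nz: "L i j k \<noteq> 0" if "i \<noteq> j" "i \<noteq> k" "j \<noteq> k" for i j k
  proof -
    have "h (root_vector i k) (root_vector j i) = h (root_vector j i) (root_vector i k)"
      using triple_relations(2)[of j i k] that by blast
    then show "L i k j = L i j k"
      by (simp add: L_def root_vector_swap[of i j] del: root_vector)
    show "L i j k \<noteq> 0"
      using triple_relations(3)[of j i k] that by (simp add: L del: root_vector)
  qed
  have move: "L i j l = L i j k" if "i \<noteq> j" "i \<noteq> k" "j \<noteq> k" "i \<noteq> l" "j \<noteq> l" for i j k l
  proof (cases "k = l")
    case False
    then have "h (root_vector i j) (root_vector k l) = 0"
      using that by (intro root_vectors_orthogonal) auto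
    then have "h (root_vector i j) (root_vector i k + root_vector k l) = L i j k"
      by (simp add: L_def del: root_vector)
    then show ?thesis
      by (simp add: L_def root_vector_add del: root_vector)
  qed simp
  have indep: "L i j k = L i j' k'"
    if "i \<noteq> j" "i \<noteq> k" "j \<noteq> k" "i \<noteq> j'" "i \<noteq> k'" "j' \<noteq> k'" for i j k j' k'
  proof (cases "j' = j")
    case True
    then show ?thesis
      using move[of i j k' k] that by simp
  next
    case False
    have "L i j k = L i j j'"
      using that False by (intro move[symmetric]) auto
    also have "\<dots> = L i j' j"
      using that False by (intro sym) auto
    also have "\<dots> = L i j' k'"
      using that False by (intro move[symmetric]) auto
    finally show ?thesis .
  qed
  have "\<exists>l. l \<noteq> 0 \<and> (\<forall>j k. i \<noteq> j \<longrightarrow> i \<noteq> k \<longrightarrow> j \<noteq> k \<longrightarrow> L i j k = of_real l)" for i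
  proof -
    obtain j where "j \<noteq> i"
      using ex_third[OF card_ge_3, of i i] by blast
    moreover obtain k where "k \<noteq> i" "k \<noteq> j"
      using ex_third[OF card_ge_3, of i j] by blast
    ultimately have jk: "j \<noteq> k" "i \<noteq> j" "i \<noteq> k"
      by auto
    have "cnj (L i j k) = L i k j"
      unfolding L_def by (metis commute)
    then have "Im (L i j k) = 0"
      using sym[of i j k] jk by (simp add: complex_eq_iff)
    then have real: "L i j k = of_real (Re (L i j k))"
      by (simp add: complex_eq_iff)
    show ?thesis
    proof (intro exI[of _ "Re (L i j k)"] conjI allI impI)
      show "Re (L i j k) \<noteq> 0"
        using nz[of i j k] jk real by (metis of_real_0)
      show "L i j' k' = of_real (Re (L i j k))" if "i \<noteq> j'" "i \<noteq> k'" "j' \<noteq> k'" for j' k'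
        using indep[of i j' k' j k] that jk real by simp
    qed
  qed
  then obtain lam where "\<And>i. lam i \<noteq> 0"
    "\<And>i j k. i \<noteq> j \<Longrightarrow> i \<noteq> k \<Longrightarrow> j \<noteq> k \<Longrightarrow> L i j k = of_real (lam i)"
    by metis
  then show thesis
    using that unfolding L_def by blast
qed

lemma is_lauricella:
  "\<exists>\<mu> c. lauricella_weights \<mu> \<and> c \<noteq> 0 \<and> lauricella_inner \<mu> = h \<and>
     (\<forall>i j. i \<noteq> j \<longrightarrow> \<kappa> (root_hyperplane i j) = c * of_real (\<mu> i + \<mu> j))"
proof -
  obtain lam :: "'n \<Rightarrow> real" where lam: "\<And>i. lam i \<noteq> 0"
    and gram: "\<And>i j k. i \<noteq> j \<Longrightarrow> i \<noteq> k \<Longrightarrow> j \<noteq> k \<Longrightarrow>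
      h (root_vector i j) (root_vector i k) = of_real (lam i)"
    using gram_invariants by blast
  have norm: "h (root_vector i j) (root_vector i j) = of_real (lam i + lam j)" if "i \<noteq> j" for i j
    by (rule norm_root_vector[OF card_ge_3 lam _ that]) (rule gram)
  have lauricella: "lauricella_weights (\<lambda>i. 1 / lam i)" "lauricella_inner (\<lambda>i. 1 / lam i) = h"
    by (rule lauricella_of_gram(2,3)[OF card_ge_3 lam]; rule gram; assumption)+
  \<comment> \<open>Off the diagonal \<open>g\<close> is constant, and its value is the factor of proportionality.\<close>
  define g where "g i j = weight i j * of_real (lam i) * of_real (lam j)" for i j
  have g_swap: "g j i = g i j" for i j
    by (simp add: g_def weight_swap[of i j])
  have g_move: "g j k = g k i" if "i \<noteq> j" "j \<noteq> k" "i \<noteq> k" for i j k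
  proof -
    have "h (root_vector i j) (root_vector j k) = - of_real (lam j)"
      unfolding root_vector_swap[of i j] minus_left using gram[of j i k] that by simp
    moreover have "h (root_vector i j) (root_vector k i) = - of_real (lam i)"
      unfolding root_vector_swap[of k i] minus_right using gram[of i j k] that by simp
    ultimately have "weight j k * of_real (lam j) = weight k i * of_real (lam i)"
      using triple_relations(1)[OF that] by simp
    then show ?thesis
      by (simp add: g_def)
  qed
  have g_eq: "g i j = g k l" if "i \<noteq> j" "k \<noteq> l" for i j k l
  proof -
    have share: "g i j = g i k" if "i \<noteq> j" "i \<noteq> k" for i j k
      using that g_move[of j k i] g_swap[of i k] by (cases "j = k") auto
    show ?thesis
    proof (cases "i = k")
      case True
      then show ?thesis
        using share[of i j l] that by simp
    next
      case False
      have "g i j = g i k"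
        using that False by (intro share) auto
      also have "\<dots> = g k l"
        using that False g_swap[of i k] share[of k i l] by auto
      finally show ?thesis .
    qed
  qed
  obtain a b :: 'n where ab: "a \<noteq> b"
    using ex_third[OF card_ge_3] by blast
  have kappa: "\<kappa> (root_hyperplane i j) = g a b * of_real (1 / lam i + 1 / lam j)" if "i \<noteq> j" for i j
  proof -
    have "h (root_vector i j) (root_vector i j) \<noteq> 0"
      using that root_vector_nonzero self_eq_0_iff by blast
    then have "\<kappa> (root_hyperplane i j) = weight i j * of_real (lam i + lam j)"
      by (simp add: weight_def norm[OF that] del: root_vector)
    also have "\<dots> = g i j * of_real (1 / lam i + 1 / lam j)"
      using lam by (simp add: g_def field_simps)
    finally show ?thesis
      using g_eq[OF that ab] by simp
  qed
  have "g a b \<noteq> 0"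
    using lam weight_nonzero[OF ab] by (simp add: g_def)
  then show ?thesis
    using lauricella kappa by blast
qed

end

theorem proposition2p24:
  fixes n :: nat
    and h :: "'n::{finite,linorder} type_A \<Rightarrow> 'n type_A \<Rightarrow> complex"
    and \<kappa> :: "'n type_A set \<Rightarrow> complex"
    and \<Omega> :: "'n type_A \<Rightarrow> 'n type_A \<Rightarrow> 'n type_A \<Rightarrow> 'n type_A"
  assumes "n \<ge> 2" and "CARD('n) = n + 1"
    and "dunkl_form arrangement_A h \<kappa> \<Omega>"
    and "\<forall>H\<in>arrangement_A. \<kappa> H \<noteq> 0"
  shows "\<exists>\<mu> c. lauricella_weights \<mu> \<and> c \<noteq> 0 \<and>
           (\<forall>z\<in>arrangement_complement arrangement_A. \<forall>u v.
              \<Omega> z u v = c *\<^sub>C lauricella_form \<mu> z u v)"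
proof -
  interpret dunkl_type_A h \<kappa> \<Omega>
    using assms by unfold_locales (simp_all add: dunkl_form_def root_hyperplane_in_arrangement)
  obtain \<mu> c where \<mu>: "lauricella_weights \<mu>" "c \<noteq> 0" "lauricella_inner \<mu> = h"
    and \<kappa>: "\<And>i j. i \<noteq> j \<Longrightarrow> \<kappa> (root_hyperplane i j) = c * of_real (\<mu> i + \<mu> j)"
    using is_lauricella by blast
  have bij: "bij_betw (\<lambda>(i, j). root_hyperplane i j) {(i, j). i < j} (arrangement_A :: 'n type_A set set)"
    by (auto simp: bij_betw_def inj_on_def arrangement_A_def root_hyperplane_eq_iff doubleton_eq_iff)
  have "\<Omega> z u v = c *\<^sub>C lauricella_form \<mu> z u v" if z: "z \<in> arrangement_complement arrangement_A" for z u v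
  proof -
    have "\<Omega> z u v = (\<Sum>(i, j)\<in>{(i, j). i < j}. log_form (root_hyperplane i j) z u *\<^sub>C residue (root_hyperplane i j) v)"
      unfolding dunkl_value[OF z] sum.reindex_bij_betw[OF bij, symmetric] by (simp add: case_prod_unfold)
    also have "\<dots> = c *\<^sub>C lauricella_form \<mu> z u v"
      unfolding lauricella_form_def scaleC_sum_right \<mu>(3)
      by (intro sum.cong refl) (auto simp: residue_def \<kappa> scaleC_scaleC mult_ac)
    finally show ?thesis .
  qed
  then show ?thesis
    using \<mu> by blast
qed

end
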